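(* Let $a,b\in\mathbb{R}^+\cup\{\infty\}$, $n\ge1$, $\Lambda:=(-a,b)\times\mathbb{R}^n\times\mathbb{R}$, and let $(t_\varepsilon)_\varepsilon$, $(s_\varepsilon)_\varepsilon$, $s$ satisfy the following hypotheses: (1) $t_\varepsilon(U,X,V)=(U,\,x_\varepsilon(U,X),\,V+g_\varepsilon(U,X)+h_\varepsilon(U,X))$ with $x_\varepsilon\in C^\infty((-a,b)\times\mathbb{R}^n,\mathbb{R}^n)$, $g_\varepsilon,h_\varepsilon\in C^\infty((-a,b)\times\mathbb{R}^n,\mathbb{R})$, $(h_\varepsilon)_\varepsilon$ uniformly bounded on compact subsets of $(-a,b)\times\mathbb{R}^n$, and $(t_\varepsilon)_\varepsilon$ has property (E+); (2) $s_\varepsilon(U,X,V)=(U,\,x_\varepsilon(U,X),\,V+g_\varepsilon(U,X))$ and $(s_\varepsilon)_\varepsilon$ has property (E); (3) $s(U,X,V)=(U,\,x(U,X),\,V+g(U,X))$ with $x,g$ continuous, and $\hat s:=(U,x)$ is injective on some open $W\subseteq(-a,b)\times\mathbb{R}^n$ containing $(-a,0]\times\mathbb{R}^n$; (4) $s_\varepsilon\to s$ uniformly on compact subsets of $\Lambda$; (5) $T:=[(t_\varepsilon)_\varepsilon]\in\mathcal{G}[\Lambda,\Lambda]$ and $S:=[(s_\varepsilon)_\varepsilon]\in\mathcal{G}[\Lambda,\Lambda]$. Then for every $p\in\Lambda$ with $U$-coordinate $0$ there exists an open neighbourhood $A$ of $p$ in $\Lambda$ such that $T$ is invertible on $A$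 with inversion data $[A,\mathbb{R}^{n+2},T^\diamond,B,Q]$, where $T^\diamond\in\mathcal{G}[\mathbb{R}^{n+2},D]$ and $B,Q,D$ are bounded open subsets of $\Lambda$ with $Q\subseteq B$ and $A\subseteq D$.
   Context: Colombeau setting: for open $U\subseteq\mathbb{R}^n$, $\mathcal{E}(U)=C^\infty(U,\mathbb{R})^{(0,1]}$; $\mathcal{E}_M(U)$ (moderate nets) consists of $(u_\varepsilon)_\varepsilon$ with: for all compact $K\subseteq U$ and $\alpha\in\mathbb{N}_0^n$ there is $N$ with $\sup_K|\partial^\alpha u_\varepsilon|=O(\varepsilon^{-N})$ as $\varepsilon\to0$; $\mathcal{N}(U)$ (negligible nets) consists of $(u_\varepsilon)_\varepsilon$ with $\sup_K|\partial^\alpha u_\varepsilon|=O(\varepsilon^m)$ for all $K$, $\alpha$, $m$; $\mathcal{G}(U)=\mathcal{E}_M(U)/\mathcal{N}(U)$, with classes denoted $[(u_\varepsilon)_\varepsilon]$. For open $U\subseteq\mathbb{R}^n$, $V\subseteq\mathbb{R}^m$, a net $(u_\varepsilon)_\varepsilon\in C^\infty(U,V)^{(0,1]}$ is c-bounded from $U$ into $V$ if (1) for every compact $K\subseteq U$ there are compact $L\subseteq V$ and $\varepsilon_0$ with $u_\varepsilon(K)\subseteq L$ for $\varepsilon\le\varepsilon_0$, and (2) all components of $(u_\varepsilon)_\varepsilon$ are moderate; $u\in\mathcal{G}(U)^m$ is c-bounded from $U$ into $V$ if it has a representative with these properties (it suffices that they hold for $\varepsilon$ below some $\varepsilon_1$);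 $\mathcal{G}[U,V]$ denotes the set of such $u$. If $u\in\mathcal{G}(U)^m$ is c-bounded into $V$ and $v\in\mathcal{G}(V)^p$, the composition $v\circ u:=[(v_\varepsilon\circ u_\varepsilon)_\varepsilon]\in\mathcal{G}(U)^p$ is well defined. Invertibility: for open $U\subseteq\mathbb{R}^n$, $u\in\mathcal{G}(U)^n$ and open $G\subseteq U$: $u$ is left invertible on $G$ with data $[G,V,v,H]$ if $V\subseteq\mathbb{R}^n$ is open, $v\in\mathcal{G}(V)^n$, $H\subseteq V$ is open, $u|_G$ is c-bounded into $H$ and $v\circ u|_G=\mathrm{id}_G$; $u$ is right invertible on $G$ with data $[G,V,v,H]$ if $v|_H$ is c-bounded into $G$ and $u\circ v|_H=\mathrm{id}_H$; $u$ is invertible on $G$ with inversion data $[G,V,v,H_l,H_r]$ if it is left invertible with data $[G,V,v,H_l]$ and right invertible with data $[G,V,v,H_r]$. Property (E): a net $(u_\varepsilon)_\varepsilon$ of smooth maps $(-a,b)\times\mathbb{R}^n\times\mathbb{R}\to(-a,b)\times\mathbb{R}^n\times\mathbb{R}$ has property (E) if for every compact $K\subseteq\mathbb{R}^n$ there exist $\alpha\in(0,b)$ and $\varepsilon_0\in(0,1]$ such that $u_\varepsilon$ is injective on $(-a,\alpha]\times K\times\mathbb{R}$ for all $\varepsilon\le\varepsilon_0$. It has property (E+) if for every compact $K\subseteq\mathbb{R}^n$ there exist $\alpha\in(0,b)$, $\varepsilon_0\in(0,1]$, $C>0$, $N\in\mathbb{N}$ such that for all $\varepsilon\le\varepsilon_0$,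 $u_\varepsilon$ is injective on $(-a,\alpha]\times K\times\mathbb{R}$ and $|\det Du_\varepsilon(U,X,V)|\ge C\varepsilon^N$ for all $(U,X,V)\in(-a,\alpha]\times K\times\mathbb{R}$. *)

theory Defs
  imports "HOL-Analysis.Analysis"
begin

definition dderiv :: "'a::euclidean_space \<Rightarrow> ('a \<Rightarrow> real) \<Rightarrow> 'a \<Rightarrow> real" where
  "dderiv v f x = frechet_derivative f (at x) v"

text \<open>Iterated partial derivative; a multi-index is encoded as a list of basis vectors.\<close>
fun iter_deriv :: "'a::euclidean_space list \<Rightarrow> ('a \<Rightarrow> real) \<Rightarrow> 'a \<Rightarrow> real" where
  "iter_deriv [] f = f"
| "iter_deriv (v # vs) f = dderiv v (iter_deriv vs f)"

definition smooth_on :: "'a::euclidean_space set \<Rightarrow> ('a \<Rightarrow> real) \<Rightarrow> bool" where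
  "smooth_on U f \<longleftrightarrow> (\<forall>vs\<in>lists Basis. \<forall>x\<in>U. iter_deriv vs f differentiable (at x))"

definition vsmooth_on :: "'a::euclidean_space set \<Rightarrow> ('a \<Rightarrow> 'b::euclidean_space) \<Rightarrow> bool" where
  "vsmooth_on U f \<longleftrightarrow> (\<forall>i\<in>Basis. smooth_on U (\<lambda>y. f y \<bullet> i))"

definition moderate :: "'a::euclidean_space set \<Rightarrow> (real \<Rightarrow> 'a \<Rightarrow> 'b::euclidean_space) \<Rightarrow> bool" where
  "moderate U u \<longleftrightarrow>
     (\<forall>\<epsilon>. 0 < \<epsilon> \<and> \<epsilon> \<le> 1 \<longrightarrow> vsmooth_on U (u \<epsilon>)) \<and>
     (\<forall>K. compact K \<and> K \<subseteq> U \<longrightarrow> (\<forall>vs\<in>lists Basis. \<forall>i\<in>Basis.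
        \<exists>N::nat. \<exists>C \<epsilon>0. \<epsilon>0 > 0 \<and> (\<forall>\<epsilon>. 0 < \<epsilon> \<and> \<epsilon> \<le> \<epsilon>0 \<and> \<epsilon> \<le> 1 \<longrightarrow>
          (\<forall>x\<in>K. \<bar>iter_deriv vs (\<lambda>y. u \<epsilon> y \<bullet> i) x\<bar> \<le> C * \<epsilon> powr (- real N)))))"

definition negligible_net :: "'a::euclidean_space set \<Rightarrow> (real \<Rightarrow> 'a \<Rightarrow> 'b::euclidean_space) \<Rightarrow> bool" where
  "negligible_net U u \<longleftrightarrow>
     (\<forall>K. compact K \<and> K \<subseteq> U \<longrightarrow> (\<forall>vs\<in>lists Basis. \<forall>i\<in>Basis. \<forall>m::nat.
        \<exists>C \<epsilon>0. \<epsilon>0 > 0 \<and> (\<forall>\<epsilon>. 0 < \<epsilon> \<and> \<epsilon> \<le> \<epsilon>0 \<and> \<epsilon> \<le> 1 \<longrightarrow>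
          (\<forall>x\<in>K. \<bar>iter_deriv vs (\<lambda>y. u \<epsilon> y \<bullet> i) x\<bar> \<le> C * \<epsilon> ^ m))))"

text \<open>Two nets represent the same element of G(U)^m.\<close>
definition gequiv :: "'a::euclidean_space set \<Rightarrow> (real \<Rightarrow> 'a \<Rightarrow> 'b::euclidean_space) \<Rightarrow> (real \<Rightarrow> 'a \<Rightarrow> 'b) \<Rightarrow> bool" where
  "gequiv U u v \<longleftrightarrow> negligible_net U (\<lambda>\<epsilon> x. u \<epsilon> x - v \<epsilon> x)"

definition cbounded_net :: "'a::euclidean_space set \<Rightarrow> 'b::euclidean_space set \<Rightarrow> (real \<Rightarrow> 'a \<Rightarrow> 'b) \<Rightarrow> bool" where
  "cbounded_net U V u \<longleftrightarrow>
     (\<forall>K. compact K \<and> K \<subseteq> U \<longrightarrow>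
        (\<exists>L \<epsilon>0. compact L \<and> L \<subseteq> V \<and> \<epsilon>0 > 0 \<and>
           (\<forall>\<epsilon>. 0 < \<epsilon> \<and> \<epsilon> \<le> \<epsilon>0 \<and> \<epsilon> \<le> 1 \<longrightarrow> u \<epsilon> ` K \<subseteq> L))) \<and>
     moderate U u"

text \<open>The class of the moderate net u lies in G[U,V].\<close>
definition gcbounded :: "'a::euclidean_space set \<Rightarrow> 'b::euclidean_space set \<Rightarrow> (real \<Rightarrow> 'a \<Rightarrow> 'b) \<Rightarrow> bool" where
  "gcbounded U V u \<longleftrightarrow> moderate U u \<and> (\<exists>u'. cbounded_net U V u' \<and> gequiv U u u')"

definition left_invertible ::
  "'a::euclidean_space set \<Rightarrow> (real \<Rightarrow> 'a \<Rightarrow> 'a) \<Rightarrow> 'a set \<Rightarrow> 'a set \<Rightarrow> (real \<Rightarrow> 'a \<Rightarrow> 'a) \<Rightarrow> 'a set \<Rightarrow> bool" where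
  "left_invertible U u G V v H \<longleftrightarrow>
     open U \<and> moderate U u \<and> open G \<and> G \<subseteq> U \<and>
     open V \<and> moderate V v \<and> open H \<and> H \<subseteq> V \<and>
     (\<exists>u'. cbounded_net G H u' \<and> gequiv G u u' \<and>
        negligible_net G (\<lambda>\<epsilon> x. v \<epsilon> (u' \<epsilon> x) - x))"

definition right_invertible ::
  "'a::euclidean_space set \<Rightarrow> (real \<Rightarrow> 'a \<Rightarrow> 'a) \<Rightarrow> 'a set \<Rightarrow> 'a set \<Rightarrow> (real \<Rightarrow> 'a \<Rightarrow> 'a) \<Rightarrow> 'a set \<Rightarrow> bool" where
  "right_invertible U u G V v H \<longleftrightarrow>
     open U \<and> moderate U u \<and> open G \<and> G \<subseteq> U \<and>
     open V \<and> moderate V v \<and> open H \<and> H \<subseteq> V \<and>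
     (\<exists>v'. cbounded_net H G v' \<and> gequiv H v v' \<and>
        negligible_net H (\<lambda>\<epsilon> y. u \<epsilon> (v' \<epsilon> y) - y))"

definition invertible_on ::
  "'a::euclidean_space set \<Rightarrow> (real \<Rightarrow> 'a \<Rightarrow> 'a) \<Rightarrow> 'a set \<Rightarrow> 'a set \<Rightarrow> (real \<Rightarrow> 'a \<Rightarrow> 'a) \<Rightarrow> 'a set \<Rightarrow> 'a set \<Rightarrow> bool" where
  "invertible_on U u G V v Hl Hr \<longleftrightarrow> left_invertible U u G V v Hl \<and> right_invertible U u G V v Hr"

definition ival :: "ereal \<Rightarrow> ereal \<Rightarrow> real set" where
  "ival a b = {u. - a < ereal u \<and> ereal u < b}"

definition Lam :: "ereal \<Rightarrow> ereal \<Rightarrow> (real \<times> 'n::euclidean_space \<times> real) set" where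
  "Lam a b = {(u, X, v). u \<in> ival a b}"

definition ldet :: "('a::euclidean_space \<Rightarrow> 'a) \<Rightarrow> real" where
  "ldet L = (\<Sum>p | p permutes (Basis::'a set). of_int (sign p) * (\<Prod>i\<in>Basis. L (p i) \<bullet> i))"

definition propE :: "ereal \<Rightarrow> ereal \<Rightarrow> (real \<Rightarrow> real \<times> 'n::euclidean_space \<times> real \<Rightarrow> real \<times> 'n \<times> real) \<Rightarrow> bool" where
  "propE a b u \<longleftrightarrow> (\<forall>K::'n set. compact K \<longrightarrow>
     (\<exists>\<alpha> \<epsilon>0. 0 < \<alpha> \<and> ereal \<alpha> < b \<and> 0 < \<epsilon>0 \<and> \<epsilon>0 \<le> 1 \<and>
        (\<forall>\<epsilon>. 0 < \<epsilon> \<and> \<epsilon> \<le> \<epsilon>0 \<longrightarrow>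
           inj_on (u \<epsilon>) {(r, X, v). - a < ereal r \<and> r \<le> \<alpha> \<and> X \<in> K})))"

definition propEplus :: "ereal \<Rightarrow> ereal \<Rightarrow> (real \<Rightarrow> real \<times> 'n::euclidean_space \<times> real \<Rightarrow> real \<times> 'n \<times> real) \<Rightarrow> bool" where
  "propEplus a b u \<longleftrightarrow> (\<forall>K::'n set. compact K \<longrightarrow>
     (\<exists>\<alpha> \<epsilon>0 C (N::nat). 0 < \<alpha> \<and> ereal \<alpha> < b \<and> 0 < \<epsilon>0 \<and> \<epsilon>0 \<le> 1 \<and> C > 0 \<and>
        (\<forall>\<epsilon>. 0 < \<epsilon> \<and> \<epsilon> \<le> \<epsilon>0 \<longrightarrow>
           inj_on (u \<epsilon>) {(r, X, v). - a < ereal r \<and> r \<le> \<alpha> \<and> X \<in> K} \<and>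
           (\<forall>p\<in>{(r, X, v). - a < ereal r \<and> r \<le> \<alpha> \<and> X \<in> K}.
              \<bar>ldet (frechet_derivative (u \<epsilon>) (at p))\<bar> \<ge> C * \<epsilon> ^ N))))"

end

theory Submission
  imports Defs "HOL-Real_Asymp.Real_Asymp"
begin

text \<open>
  The net \<open>t \<epsilon>\<close> has the form \<open>(q, v) \<mapsto> (\<phi> \<epsilon> q, v + f \<epsilon> q)\<close> over the base point \<open>q = (u, X)\<close>.
  Near the base point of \<open>p\<close> the maps \<open>\<phi> \<epsilon>\<close> converge uniformly to an injective continuous map, while
  each of them is injective and, by invariance of domain, open; since they stay away from the limit
  image of the centre on a small sphere, a connectedness argument shows that the images of a small
  ball contain a ball that does not depend on \<open>\<epsilon>\<close>. As \<open>f \<epsilon>\<close> is bounded uniformly in \<open>\<epsilon>\<close>, the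
  inverses of \<open>t \<epsilon>\<close> exist on a cylinder independent of \<open>\<epsilon>\<close>, with values in one compact set. Cramer's
  rule and the lower bound on the Jacobian determinant express the first derivatives of the inverse
  as a moderate net composed with the inverse itself, so all its derivatives are moderate by
  induction on the order. The inverse is made global by composing it from the right with a smooth
  map that sends the whole space into the cylinder and is the identity on a neighbourhood.
\<close>

subsection \<open>Cramer's rule\<close>

text \<open>The determinant bound in (E+) degenerates like a power of \<epsilon>, so a quantitative
  inverse function theorem would only give neighbourhoods that shrink with \<epsilon>. Therefore the
  size of all domains comes from topology, that is from injectivity and uniform convergence, while
  the determinant serves only to differentiate inverses that already exist and to estimate their
  derivatives. The merely bounded terms \<open>h\<epsilon>\<close> spoil convergence of the full
  net. Convergence is used in the base variables only; the last component is a translation and is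
  solved explicitly, at the price of a shift by at most a fixed constant \<open>M\<close>. This
  shift dictates the sizes of the sets: \<open>t \<epsilon>\<close> must send \<open>A\<close> into
  a compact part of \<open>B\<close>, and the inverse must send \<open>Q\<close> into a compact part
  of \<open>A\<close>, so the heights need a margin larger than \<open>M\<close> in both directions.
  Extending the inverse by truncating its argument with a map independent of \<epsilon> leaves no
  error term: for small \<epsilon> both compositions equal the identity exactly, so negligibility is
  immediate.\<close>

lemma ldet_sum_column:
  fixes f :: "'a::euclidean_space \<Rightarrow> 'a"
  assumes "finite S" and j: "j \<in> Basis"
  shows "ldet (f(j := \<Sum>k\<in>S. c k *\<^sub>R y k)) = (\<Sum>k\<in>S. c k * ldet (f(j := y k)))"
proof -
  \<comment> \<open>Row \<open>i\<close> is paired with column \<open>p i\<close>, so column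
    \<open>j\<close> contributes a single factor, the one in row \<open>inv p j\<close>. Isolating
    it exhibits the linearity.\<close>
  have column: "(\<Prod>i\<in>Basis. (f(j := w)) (p i) \<bullet> i) =
      (w \<bullet> inv p j) * (\<Prod>i\<in>Basis - {inv p j}. f (p i) \<bullet> i)"
    if p: "p permutes (Basis::'a set)" for p w
  proof -
    have inv: "inv p j \<in> Basis" "p (inv p j) = j"
      using p j by (simp_all add: permutes_in_image permutes_inv permutes_inverses)
    have "p i \<noteq> j" if "i \<noteq> inv p j" for i
      using that p by (metis permutes_inverses(2))
    then show ?thesis
      using inv by (subst prod.remove[of _ "inv p j"]) (auto intro!: arg_cong2[where f="(*)"] prod.cong)
  qed
  have "ldet (f(j := \<Sum>k\<in>S. c k *\<^sub>R y k)) =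
      (\<Sum>p | p permutes (Basis::'a set). \<Sum>k\<in>S. c k * (of_int (sign p) * (\<Prod>i\<in>Basis. (f(j := y k)) (p i) \<bullet> i)))"
    unfolding ldet_def
    by (rule sum.cong) (auto simp: column inner_sum_left sum_distrib_left sum_distrib_right algebra_simps simp del: fun_upd_apply)
  also have "\<dots> = (\<Sum>k\<in>S. c k * ldet (f(j := y k)))"
    unfolding ldet_def by (subst sum.swap) (simp add: sum_distrib_left)
  finally show ?thesis .
qed

text \<open>Reindexing the sum by \<open>p \<mapsto> ?t \<circ> p\<close> flips every sign but keeps
  every product, because \<open>f\<close> does not see the transposition. Hence
  \<open>ldet f = - ldet f\<close>.\<close>

lemma ldet_equal_columns:
  fixes f :: "'a::euclidean_space \<Rightarrow> 'a"
  assumes "j \<in> Basis" "k \<in> Basis" "j \<noteq> k" "f j = f k"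
  shows "ldet f = 0"
proof -
  let ?t = "Transposition.transpose j k"
  let ?F = "\<lambda>p. real_of_int (sign p) * (\<Prod>i\<in>Basis. f (p i) \<bullet> i)"
  have t: "?t permutes Basis"
    using assms by (simp add: permutes_swap_id)
  have ft: "f (?t b) = f b" for b
    using assms by (simp add: Transposition.transpose_def)
  have "?F (?t \<circ> p) = - ?F p" if "p permutes Basis" for p
    using that t assms
    by (simp add: ft sign_compose sign_swap_id permutes_imp_permutation[OF finite_Basis])
  then have "ldet f = - ldet f"
    unfolding ldet_def
    by (subst setum_permutations_compose_left[OF t]) (auto simp: sum_negf[symmetric] intro!: sum.cong)
  then show ?thesis by simp
qed

text \<open>Updating \<open>L\<close> at the basis vector \<open>j\<close> replaces the
  \<open>j\<close>-th column. After expanding \<open>L x\<close> in the columns of \<open>L\<close>,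
  every term with \<open>k \<noteq> j\<close> has two equal columns and drops out.\<close>

lemma ldet_Cramer:
  fixes L :: "'a::euclidean_space \<Rightarrow> 'a"
  assumes "linear L" and j: "j \<in> Basis"
  shows "ldet (L(j := L x)) = (x \<bullet> j) * ldet L"
proof -
  have "L x = L (\<Sum>k\<in>Basis. (x \<bullet> k) *\<^sub>R k)"
    by (simp add: euclidean_representation)
  also have "\<dots> = (\<Sum>k\<in>Basis. (x \<bullet> k) *\<^sub>R L k)"
    using assms(1) by (simp add: linear_sum linear_scale)
  finally have "ldet (L(j := L x)) = (\<Sum>k\<in>Basis. (x \<bullet> k) * ldet (L(j := L k)))"
    using ldet_sum_column[OF finite_Basis j, of L "\<lambda>k. x \<bullet> k" L] by simp
  also have "\<dots> = (\<Sum>k\<in>Basis. if k = j then (x \<bullet> j) * ldet L else 0)"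
    using ldet_equal_columns[OF j, of _ "L(j := L _)"] by (intro sum.cong) auto
  finally show ?thesis using j by simp
qed

lemma ldet_nonzero_imp_inj:
  fixes L :: "'a::euclidean_space \<Rightarrow> 'a"
  assumes "linear L" "ldet L \<noteq> 0"
  shows "inj L"
proof -
  have "x = 0" if "L x = 0" for x
  proof (rule euclidean_eqI)
    fix j :: 'a assume "j \<in> Basis"
    \<comment> \<open>The zero column is the empty linear combination.\<close>
    moreover have "ldet (L(j := 0)) = 0"
      using ldet_sum_column[of "{}" j L] \<open>j \<in> Basis\<close> by simp
    ultimately show "x \<bullet> j = 0 \<bullet> j"
      using ldet_Cramer[OF assms(1), of j x] that assms(2) by simp
  qed
  then show ?thesis using assms(1) by (simp add: linear_injective_0)
qed

subsection \<open>Moderate nets up to a given order\<close>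

lemma dderiv_eqI: "(f has_derivative f') (at x) \<Longrightarrow> dderiv v f x = f' v"
  by (simp add: dderiv_def frechet_derivative_at[symmetric])

lemma has_derivative_dderiv:
  "f differentiable (at x) \<Longrightarrow> (f has_derivative (\<lambda>v. dderiv v f x)) (at x)"
  unfolding dderiv_def using frechet_derivative_works by blast

lemma has_derivative_cong_open:
  assumes "open U" "x \<in> U" "\<And>y. y \<in> U \<Longrightarrow> f y = g y"
  shows "(f has_derivative D) (at x) \<longleftrightarrow> (g has_derivative D) (at x)"
  using has_derivative_transform_within_open[OF _ assms(1,2)] assms(3) by metis

text \<open>Holds even where \<open>f\<close> has no derivative: \<open>frechet_derivative\<close>
  is a choice that depends only on the predicate \<open>has_derivative\<close>, and this predicate
  is the same for both functions at \<open>x\<close>.\<close>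

lemma dderiv_cong_open:
  assumes "open U" "x \<in> U" "\<And>y. y \<in> U \<Longrightarrow> f y = g y"
  shows "dderiv v f x = dderiv v g x"
  unfolding dderiv_def frechet_derivative_def by (simp only: has_derivative_cong_open[OF assms])

lemma differentiable_cong_open:
  assumes "open U" "x \<in> U" "\<And>y. y \<in> U \<Longrightarrow> f y = g y" "f differentiable (at x)"
  shows "g differentiable (at x)"
  using assms(4) unfolding differentiable_def by (simp only: has_derivative_cong_open[OF assms(1-3)])

lemma iter_deriv_append: "iter_deriv (xs @ ys) f = iter_deriv xs (iter_deriv ys f)"
  by (induction xs) auto

lemma iter_deriv_cong_open:
  assumes "open U" "\<And>y. y \<in> U \<Longrightarrow> f y = g y" "x \<in> U"
  shows "iter_deriv vs f x = iter_deriv vs g x"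
  using assms(3)
proof (induction vs arbitrary: x)
  case (Cons v vs)
  show ?case using dderiv_cong_open[OF assms(1) Cons.prems Cons.IH] by simp
qed (simp add: assms)

lemma dderiv_const [simp]: "dderiv v (\<lambda>x. c) = (\<lambda>x. 0)"
  by (auto simp: dderiv_def)

lemma iter_deriv_const: "iter_deriv vs (\<lambda>x. c) = (\<lambda>x. if vs = [] then c else 0)"
  by (induction vs) auto

text \<open>No constant is needed in front of \<open>(1/\<epsilon>) ^ N\<close>: for small \<open>\<epsilon>\<close> it is absorbed by a larger \<open>N\<close>.\<close>

definition moderate_bound :: "'a::topological_space set \<Rightarrow> (real \<Rightarrow> 'a \<Rightarrow> real) \<Rightarrow> bool" where
  "moderate_bound U f \<longleftrightarrow> (\<forall>K. compact K \<and> K \<subseteq> U \<longrightarrow>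
     (\<exists>N::nat. \<forall>\<^sub>F \<epsilon> in at_right 0. \<forall>x\<in>K. \<bar>f \<epsilon> x\<bar> \<le> (1/\<epsilon>) ^ N))"

lemma moderate_boundI:
  assumes "\<And>K. compact K \<Longrightarrow> K \<subseteq> U \<Longrightarrow>
     \<exists>N::nat. \<exists>C. \<forall>\<^sub>F \<epsilon> in at_right 0. \<forall>x\<in>K. \<bar>f \<epsilon> x\<bar> \<le> C * (1/\<epsilon>) ^ N"
  shows "moderate_bound U f"
  unfolding moderate_bound_def
proof (intro allI impI)
  fix K assume K: "compact K \<and> K \<subseteq> U"
  then obtain N :: nat and C where *: "\<forall>\<^sub>F \<epsilon> in at_right 0. \<forall>x\<in>K. \<bar>f \<epsilon> x\<bar> \<le> C * (1/\<epsilon>) ^ N"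
    using assms by blast
  have "\<forall>\<^sub>F \<epsilon> in at_right 0. \<epsilon> < 1 / (1 + \<bar>C\<bar>)"
    by (auto simp: eventually_at_right_field intro!: exI[of _ "1 / (1 + \<bar>C\<bar>)"])
  then have "\<forall>\<^sub>F \<epsilon> in at_right 0. \<forall>x\<in>K. \<bar>f \<epsilon> x\<bar> \<le> (1/\<epsilon>) ^ Suc N"
    using * eventually_at_right_less[of 0]
  proof eventually_elim
    case (elim \<epsilon>)
    have "1 + \<bar>C\<bar> < 1 / \<epsilon>" using elim by (simp add: field_simps)
    then have "C \<le> 1 / \<epsilon>" by simp
    then have "C * (1/\<epsilon>) ^ N \<le> (1/\<epsilon>) ^ Suc N"
      unfolding power_Suc using elim by (intro mult_right_mono) auto
    then show ?case using elim by force
  qed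
  then show "\<exists>N::nat. \<forall>\<^sub>F \<epsilon> in at_right 0. \<forall>x\<in>K. \<bar>f \<epsilon> x\<bar> \<le> (1/\<epsilon>) ^ N" by blast
qed

lemma moderate_boundE:
  assumes "moderate_bound U f" "compact K" "K \<subseteq> U"
  obtains N :: nat where "\<forall>\<^sub>F \<epsilon> in at_right 0. \<forall>x\<in>K. \<bar>f \<epsilon> x\<bar> \<le> (1/\<epsilon>) ^ N"
  using assms by (auto simp: moderate_bound_def)

lemma eventually_at_right_le1: "\<forall>\<^sub>F \<epsilon> in at_right (0::real). \<epsilon> \<le> 1"
  by (auto simp: eventually_at_right_field intro: exI[of _ 1])

lemma moderate_bound_add:
  assumes "moderate_bound U f" "moderate_bound U g"
  shows "moderate_bound U (\<lambda>\<epsilon> x. f \<epsilon> x + g \<epsilon> x)"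
proof (rule moderate_boundI)
  fix K assume K: "compact K" "K \<subseteq> U"
  obtain M :: nat where M: "\<forall>\<^sub>F \<epsilon> in at_right 0. \<forall>x\<in>K. \<bar>f \<epsilon> x\<bar> \<le> (1/\<epsilon>) ^ M"
    using assms(1) K by (blast elim: moderate_boundE)
  obtain N :: nat where N: "\<forall>\<^sub>F \<epsilon> in at_right 0. \<forall>x\<in>K. \<bar>g \<epsilon> x\<bar> \<le> (1/\<epsilon>) ^ N"
    using assms(2) K by (blast elim: moderate_boundE)
  from M N have "\<forall>\<^sub>F \<epsilon> in at_right 0. \<forall>x\<in>K. \<bar>f \<epsilon> x + g \<epsilon> x\<bar> \<le> 2 * (1/\<epsilon>) ^ max M N"
    using eventually_at_right_less[of 0] eventually_at_right_le1
  proof eventually_elim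
    case (elim \<epsilon>)
    have "(1/\<epsilon>) ^ M \<le> (1/\<epsilon>) ^ max M N" "(1/\<epsilon>) ^ N \<le> (1/\<epsilon>) ^ max M N"
      using elim by (auto intro!: power_increasing)
    then show ?case using elim(1,2) by (smt (verit))
  qed
  then show "\<exists>N::nat. \<exists>C. \<forall>\<^sub>F \<epsilon> in at_right 0. \<forall>x\<in>K. \<bar>f \<epsilon> x + g \<epsilon> x\<bar> \<le> C * (1/\<epsilon>) ^ N"
    by blast
qed

lemma moderate_bound_mult:
  assumes "moderate_bound U f" "moderate_bound U g"
  shows "moderate_bound U (\<lambda>\<epsilon> x. f \<epsilon> x * g \<epsilon> x)"
  unfolding moderate_bound_def
proof (intro allI impI)
  fix K assume K: "compact K \<and> K \<subseteq> U"
  obtain M :: nat where M: "\<forall>\<^sub>F \<epsilon> in at_right 0. \<forall>x\<in>K. \<bar>f \<epsilon> x\<bar> \<le> (1/\<epsilon>) ^ M"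
    using assms(1) K by (blast elim: moderate_boundE)
  obtain N :: nat where N: "\<forall>\<^sub>F \<epsilon> in at_right 0. \<forall>x\<in>K. \<bar>g \<epsilon> x\<bar> \<le> (1/\<epsilon>) ^ N"
    using assms(2) K by (blast elim: moderate_boundE)
  from M N have "\<forall>\<^sub>F \<epsilon> in at_right 0. \<forall>x\<in>K. \<bar>f \<epsilon> x * g \<epsilon> x\<bar> \<le> (1/\<epsilon>) ^ (M + N)"
    using eventually_at_right_less[of 0]
    by eventually_elim (auto simp: abs_mult power_add intro!: mult_mono)
  then show "\<exists>N::nat. \<forall>\<^sub>F \<epsilon> in at_right 0. \<forall>x\<in>K. \<bar>f \<epsilon> x * g \<epsilon> x\<bar> \<le> (1/\<epsilon>) ^ N"
    by blast
qed

lemma moderate_bound_continuous: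
  assumes "continuous_on U f"
  shows "moderate_bound U (\<lambda>\<epsilon>. f)"
proof (rule moderate_boundI)
  fix K assume K: "compact K" "K \<subseteq> U"
  then have "bounded (f ` K)"
    using assms continuous_on_subset compact_continuous_image compact_imp_bounded by metis
  then obtain C where "\<forall>x\<in>K. \<bar>f x\<bar> \<le> C"
    by (auto simp: bounded_iff)
  then have "\<forall>\<^sub>F \<epsilon> in at_right (0::real). \<forall>x\<in>K. \<bar>f x\<bar> \<le> C * (1/\<epsilon>) ^ 0"
    by simp
  then show "\<exists>N::nat. \<exists>C. \<forall>\<^sub>F \<epsilon> in at_right 0. \<forall>x\<in>K. \<bar>f x\<bar> \<le> C * (1/\<epsilon>) ^ N" by blast
qed

lemma moderate_bound_cong:
  assumes "moderate_bound U f" "\<And>\<epsilon> x. 0 < \<epsilon> \<Longrightarrow> \<epsilon> \<le> e \<Longrightarrow> x \<in> U \<Longrightarrow> f \<epsilon> x = g \<epsilon> x" "e > 0"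
  shows "moderate_bound U g"
  unfolding moderate_bound_def
proof (intro allI impI)
  fix K assume K: "compact K \<and> K \<subseteq> U"
  obtain N :: nat where N: "\<forall>\<^sub>F \<epsilon> in at_right 0. \<forall>x\<in>K. \<bar>f \<epsilon> x\<bar> \<le> (1/\<epsilon>) ^ N"
    using assms(1) K by (blast elim: moderate_boundE)
  have "\<forall>\<^sub>F \<epsilon> in at_right 0. 0 < \<epsilon> \<and> \<epsilon> < e"
    using assms(3) by (auto simp: eventually_at_right_field)
  with N have "\<forall>\<^sub>F \<epsilon> in at_right 0. \<forall>x\<in>K. \<bar>g \<epsilon> x\<bar> \<le> (1/\<epsilon>) ^ N"
  proof eventually_elim
    case (elim \<epsilon>)
    show ?case
    proof
      fix x assume "x \<in> K"
      then have "f \<epsilon> x = g \<epsilon> x" using elim K by (intro assms(2)) auto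
      then show "\<bar>g \<epsilon> x\<bar> \<le> (1/\<epsilon>) ^ N" using elim \<open>x \<in> K\<close> by metis
    qed
  qed
  then show "\<exists>N::nat. \<forall>\<^sub>F \<epsilon> in at_right 0. \<forall>x\<in>K. \<bar>g \<epsilon> x\<bar> \<le> (1/\<epsilon>) ^ N" by blast
qed

lemma moderate_bound_subset: "moderate_bound U f \<Longrightarrow> V \<subseteq> U \<Longrightarrow> moderate_bound V f"
  unfolding moderate_bound_def by (meson subset_trans)

text \<open>Differentiability is required for all \<open>\<epsilon> \<le> e\<close>, since the local inverses exist only below some \<open>e\<close>.\<close>

fun moderate_upto :: "real \<Rightarrow> nat \<Rightarrow> 'a::euclidean_space set \<Rightarrow> (real \<Rightarrow> 'a \<Rightarrow> real) \<Rightarrow> bool" where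
  "moderate_upto e 0 U f \<longleftrightarrow> moderate_bound U f"
| "moderate_upto e (Suc k) U f \<longleftrightarrow> moderate_bound U f \<and>
     (\<forall>\<epsilon>. 0 < \<epsilon> \<and> \<epsilon> \<le> e \<longrightarrow> (\<forall>x\<in>U. f \<epsilon> differentiable (at x))) \<and>
     (\<forall>v\<in>Basis. moderate_upto e k U (\<lambda>\<epsilon>. dderiv v (f \<epsilon>)))"

lemma moderate_upto_bound: "moderate_upto e k U f \<Longrightarrow> moderate_bound U f"
  by (cases k) auto

lemma moderate_upto_Suc_imp: "moderate_upto e (Suc k) U f \<Longrightarrow> moderate_upto e k U f"
  by (induction k arbitrary: f) (auto dest: moderate_upto_bound)

lemma moderate_upto_subset: "moderate_upto e k U f \<Longrightarrow> V \<subseteq> U \<Longrightarrow> moderate_upto e k V f"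
  by (induction k arbitrary: f) (auto intro: moderate_bound_subset)

lemma moderate_upto_antimono: "moderate_upto e k U f \<Longrightarrow> e' \<le> e \<Longrightarrow> moderate_upto e' k U f"
  by (induction k arbitrary: f) auto

text \<open>The product, quotient and chain rules are available only for \<epsilon> up to
  \<open>e\<close> and at points of \<open>U\<close>. This rule lets such a partial formula stand in
  for the derivative net in the inductions below.\<close>

lemma moderate_upto_cong:
  assumes "moderate_upto e k U f" "open U" "0 < e"
    and "\<And>\<epsilon> x. 0 < \<epsilon> \<Longrightarrow> \<epsilon> \<le> e \<Longrightarrow> x \<in> U \<Longrightarrow> f \<epsilon> x = g \<epsilon> x"
  shows "moderate_upto e k U g"
  using assms(1,4)
proof (induction k arbitrary: f g)
  case 0
  have "moderate_bound U f" using 0 by simp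
  then have "moderate_bound U g"
    using 0(2) assms(3) by (rule moderate_bound_cong)
  then show ?case by simp
next
  case (Suc k)
  have "moderate_upto e k U (\<lambda>\<epsilon>. dderiv v (g \<epsilon>))" if "v \<in> Basis" for v
  proof (rule Suc.IH)
    show "moderate_upto e k U (\<lambda>\<epsilon>. dderiv v (f \<epsilon>))" using Suc.prems(1) that by simp
    fix \<epsilon> x assume "0 < \<epsilon>" "\<epsilon> \<le> e" "x \<in> U"
    then show "dderiv v (f \<epsilon>) x = dderiv v (g \<epsilon>) x"
      by (intro dderiv_cong_open[OF assms(2)] Suc.prems(2))
  qed
  moreover have "g \<epsilon> differentiable (at x)" if "0 < \<epsilon>" "\<epsilon> \<le> e" "x \<in> U" for \<epsilon> x
    using Suc.prems(1) that by (intro differentiable_cong_open[OF assms(2) that(3) Suc.prems(2)[OF that(1,2)]]) auto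
  moreover have "moderate_bound U g"
    using moderate_upto_bound[OF Suc.prems(1)] Suc.prems(2) assms(3) by (rule moderate_bound_cong)
  ultimately show ?case by simp
qed

lemma moderate_upto_const: "moderate_upto e k U (\<lambda>\<epsilon> x. c)"
  by (induction k arbitrary: c) (auto intro!: moderate_bound_continuous)

lemma moderate_upto_inner: "moderate_upto e k U (\<lambda>\<epsilon> x. x \<bullet> b)"
proof (cases k)
  case (Suc l)
  have "dderiv v (\<lambda>x. x \<bullet> b) = (\<lambda>x. v \<bullet> b)" for v :: 'a
    by (rule ext, rule dderiv_eqI) (auto intro!: derivative_eq_intros)
  moreover have "(\<lambda>x. x \<bullet> b) differentiable (at x)" for x :: 'a
    by (auto simp: differentiable_def intro!: derivative_eq_intros)
  ultimately show ?thesis using Suc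
    by (simp add: moderate_bound_continuous continuous_on_inner moderate_upto_const)
qed (simp add: moderate_bound_continuous continuous_on_inner)

lemma moderate_upto_add:
  assumes "open U" "0 < e"
  shows "moderate_upto e k U f \<Longrightarrow> moderate_upto e k U g \<Longrightarrow> moderate_upto e k U (\<lambda>\<epsilon> x. f \<epsilon> x + g \<epsilon> x)"
proof (induction k arbitrary: f g)
  case 0
  then show ?case by (auto intro: moderate_bound_add)
next
  case (Suc k)
  have "moderate_upto e k U (\<lambda>\<epsilon>. dderiv v (\<lambda>x. f \<epsilon> x + g \<epsilon> x))" if "v \<in> Basis" for v
  proof (rule moderate_upto_cong[OF _ assms])
    show "moderate_upto e k U (\<lambda>\<epsilon> x. dderiv v (f \<epsilon>) x + dderiv v (g \<epsilon>) x)"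
      using Suc that by auto
    fix \<epsilon> x assume "0 < \<epsilon>" "\<epsilon> \<le> e" "x \<in> U"
    then have "f \<epsilon> differentiable (at x)" "g \<epsilon> differentiable (at x)"
      using Suc.prems by auto
    then show "dderiv v (f \<epsilon>) x + dderiv v (g \<epsilon>) x = dderiv v (\<lambda>x. f \<epsilon> x + g \<epsilon> x) x"
      by (intro dderiv_eqI[symmetric] has_derivative_add has_derivative_dderiv)
  qed
  then show ?case using Suc.prems by (auto intro: moderate_bound_add)
qed

lemma moderate_upto_mult:
  assumes "open U" "0 < e"
  shows "moderate_upto e k U f \<Longrightarrow> moderate_upto e k U g \<Longrightarrow> moderate_upto e k U (\<lambda>\<epsilon> x. f \<epsilon> x * g \<epsilon> x)"
proof (induction k arbitrary: f g)
  case 0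
  then show ?case by (auto intro: moderate_bound_mult)
next
  case (Suc k)
  have "moderate_upto e k U (\<lambda>\<epsilon>. dderiv v (\<lambda>x. f \<epsilon> x * g \<epsilon> x))" if "v \<in> Basis" for v
  proof (rule moderate_upto_cong[OF _ assms])
    \<comment> \<open>In the Leibniz rule one factor stays undifferentiated; lowering its order to
      \<open>k\<close> makes the induction hypothesis applicable.\<close>
    show "moderate_upto e k U (\<lambda>\<epsilon> x. f \<epsilon> x * dderiv v (g \<epsilon>) x + dderiv v (f \<epsilon>) x * g \<epsilon> x)"
      using Suc.prems that
      by (intro moderate_upto_add assms Suc.IH Suc.prems[THEN moderate_upto_Suc_imp]) auto
    fix \<epsilon> x assume "0 < \<epsilon>" "\<epsilon> \<le> e" "x \<in> U"
    then have "f \<epsilon> differentiable (at x)" "g \<epsilon> differentiable (at x)"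
      using Suc.prems by auto
    then show "f \<epsilon> x * dderiv v (g \<epsilon>) x + dderiv v (f \<epsilon>) x * g \<epsilon> x = dderiv v (\<lambda>x. f \<epsilon> x * g \<epsilon> x) x"
      by (intro dderiv_eqI[symmetric] has_derivative_mult has_derivative_dderiv)
  qed
  then show ?case using Suc.prems by (auto intro: moderate_bound_mult)
qed

lemma moderate_upto_sum:
  assumes "open U" "0 < e" "\<And>i. i \<in> I \<Longrightarrow> moderate_upto e k U (f i)"
  shows "moderate_upto e k U (\<lambda>\<epsilon> x. \<Sum>i\<in>I. f i \<epsilon> x)"
  using assms(3)
  by (induction I rule: infinite_finite_induct) (auto intro!: moderate_upto_add assms(1,2) moderate_upto_const)

lemma moderate_upto_prod:
  assumes "open U" "0 < e" "\<And>i. i \<in> I \<Longrightarrow> moderate_upto e k U (f i)"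
  shows "moderate_upto e k U (\<lambda>\<epsilon> x. \<Prod>i\<in>I. f i \<epsilon> x)"
  using assms(3)
  by (induction I rule: infinite_finite_induct) (auto intro!: moderate_upto_mult assms(1,2) moderate_upto_const)

text \<open>The derivative of \<open>1/f\<close> is \<open>-f'/f^2\<close>, a product of
  \<open>f'\<close> with two copies of \<open>1/f\<close> of one order less. So only the order-zero
  bound \<open>b\<close> on the reciprocal has to be supplied; higher orders follow.\<close>

lemma moderate_upto_inverse:
  assumes "open U" "0 < e"
    and nz: "\<And>\<epsilon> x. 0 < \<epsilon> \<Longrightarrow> \<epsilon> \<le> e \<Longrightarrow> x \<in> U \<Longrightarrow> f \<epsilon> x \<noteq> 0"
    and b: "moderate_bound U (\<lambda>\<epsilon> x. inverse (f \<epsilon> x))"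
  shows "moderate_upto e k U f \<Longrightarrow> moderate_upto e k U (\<lambda>\<epsilon> x. inverse (f \<epsilon> x))"
proof (induction k)
  case 0
  then show ?case using b by simp
next
  case (Suc k)
  have IH: "moderate_upto e k U (\<lambda>\<epsilon> x. inverse (f \<epsilon> x))"
    using Suc moderate_upto_Suc_imp by blast
  have der: "((\<lambda>x. inverse (f \<epsilon> x)) has_derivative
      (\<lambda>v. - (inverse (f \<epsilon> x) * dderiv v (f \<epsilon>) x * inverse (f \<epsilon> x)))) (at x)"
    if "0 < \<epsilon>" "\<epsilon> \<le> e" "x \<in> U" for \<epsilon> x
    using that Suc.prems by (intro Deriv.has_derivative_inverse nz has_derivative_dderiv) auto
  have "moderate_upto e k U (\<lambda>\<epsilon>. dderiv v (\<lambda>x. inverse (f \<epsilon> x)))" if v: "v \<in> Basis" for v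
  proof (rule moderate_upto_cong[OF _ assms(1,2)])
    show "moderate_upto e k U (\<lambda>\<epsilon> x. (- 1) * (inverse (f \<epsilon> x) * dderiv v (f \<epsilon>) x * inverse (f \<epsilon> x)))"
      using Suc.prems v by (intro moderate_upto_mult assms IH moderate_upto_const) auto
    fix \<epsilon> x assume "0 < \<epsilon>" "\<epsilon> \<le> e" "x \<in> U"
    then show "(- 1) * (inverse (f \<epsilon> x) * dderiv v (f \<epsilon>) x * inverse (f \<epsilon> x)) = dderiv v (\<lambda>x. inverse (f \<epsilon> x)) x"
      using dderiv_eqI[OF der, of \<epsilon> x v] by simp
  qed
  moreover have "(\<lambda>x. inverse (f \<epsilon> x)) differentiable (at x)" if "0 < \<epsilon>" "\<epsilon> \<le> e" "x \<in> U" for \<epsilon> x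
    using der[OF that] unfolding differentiable_def by blast
  ultimately show ?case using b by auto
qed

lemma has_derivative_componentwise_dderiv:
  fixes w :: "'a::euclidean_space \<Rightarrow> 'b::euclidean_space"
  assumes "\<And>j. j \<in> Basis \<Longrightarrow> (\<lambda>x. w x \<bullet> j) differentiable (at x)"
  shows "(w has_derivative (\<lambda>v. \<Sum>j\<in>Basis. dderiv v (\<lambda>y. w y \<bullet> j) x *\<^sub>R j)) (at x)"
  using assms by (subst has_derivative_componentwise_within)
    (auto simp: inner_sum_left inner_Basis if_distrib cong: if_cong intro!: has_derivative_dderiv)

text \<open>The compact set \<open>L\<close> must lie inside \<open>V\<close>: bounded values of
  \<open>w\<close> could still approach the boundary of \<open>V\<close>, where nothing controls
  \<open>f\<close>.\<close>

lemma moderate_bound_compose: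
  assumes f: "moderate_bound V f"
    and cb: "\<And>K. compact K \<Longrightarrow> K \<subseteq> U \<Longrightarrow>
      \<exists>L. compact L \<and> L \<subseteq> V \<and> (\<forall>\<^sub>F \<epsilon> in at_right 0. w \<epsilon> ` K \<subseteq> L)"
  shows "moderate_bound U (\<lambda>\<epsilon> x. f \<epsilon> (w \<epsilon> x))"
  unfolding moderate_bound_def
proof (intro allI impI)
  fix K assume K: "compact K \<and> K \<subseteq> U"
  then obtain L where L: "compact L" "L \<subseteq> V" "\<forall>\<^sub>F \<epsilon> in at_right 0. w \<epsilon> ` K \<subseteq> L"
    using cb by meson
  then obtain N :: nat where "\<forall>\<^sub>F \<epsilon> in at_right 0. \<forall>x\<in>L. \<bar>f \<epsilon> x\<bar> \<le> (1/\<epsilon>) ^ N"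
    using f L by (blast elim: moderate_boundE)
  with L(3) have "\<forall>\<^sub>F \<epsilon> in at_right 0. \<forall>x\<in>K. \<bar>f \<epsilon> (w \<epsilon> x)\<bar> \<le> (1/\<epsilon>) ^ N"
    by eventually_elim auto
  then show "\<exists>N::nat. \<forall>\<^sub>F \<epsilon> in at_right 0. \<forall>x\<in>K. \<bar>f \<epsilon> (w \<epsilon> x)\<bar> \<le> (1/\<epsilon>) ^ N" by blast
qed

text \<open>The chain rule produces the nets \<open>dderiv j (f \<epsilon>)\<close> composed with
  the same \<open>w\<close>, hence the induction generalises over \<open>f\<close> and keeps
  \<open>w\<close> fixed. Order \<open>k\<close> of \<open>w\<close> is enough for order
  \<open>k\<close> of the composite; the bootstrap for inverses depends on this.\<close>

lemma moderate_upto_compose: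
  fixes w :: "real \<Rightarrow> 'a::euclidean_space \<Rightarrow> 'b::euclidean_space"
  assumes "open U" "0 < e"
    and maps: "\<And>\<epsilon> x. 0 < \<epsilon> \<Longrightarrow> \<epsilon> \<le> e \<Longrightarrow> x \<in> U \<Longrightarrow> w \<epsilon> x \<in> V"
    and cb: "\<And>K. compact K \<Longrightarrow> K \<subseteq> U \<Longrightarrow>
      \<exists>L. compact L \<and> L \<subseteq> V \<and> (\<forall>\<^sub>F \<epsilon> in at_right 0. w \<epsilon> ` K \<subseteq> L)"
  shows "moderate_upto e k V f \<Longrightarrow> (\<And>j. j \<in> Basis \<Longrightarrow> moderate_upto e k U (\<lambda>\<epsilon> x. w \<epsilon> x \<bullet> j)) \<Longrightarrow>
    moderate_upto e k U (\<lambda>\<epsilon> x. f \<epsilon> (w \<epsilon> x))"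
proof (induction k arbitrary: f)
  case 0
  then have "moderate_bound V f" by simp
  from moderate_bound_compose[OF this cb] show ?case by simp
next
  case (Suc k)
  have w: "moderate_upto e k U (\<lambda>\<epsilon> x. w \<epsilon> x \<bullet> j)" if "j \<in> Basis" for j
    using Suc.prems(2)[OF that] by (rule moderate_upto_Suc_imp)
  have f_diff: "f \<epsilon> differentiable (at (w \<epsilon> x))" if "0 < \<epsilon>" "\<epsilon> \<le> e" "x \<in> U" for \<epsilon> x
    using Suc.prems(1) that maps[OF that] by simp
  have w_diff: "(\<lambda>x. w \<epsilon> x \<bullet> j) differentiable (at x)"
    if "0 < \<epsilon>" "\<epsilon> \<le> e" "x \<in> U" "j \<in> Basis" for \<epsilon> x j
    using Suc.prems(2)[OF that(4)] that by simp
  have der: "((\<lambda>x. f \<epsilon> (w \<epsilon> x)) has_derivative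
      (\<lambda>v. \<Sum>j\<in>Basis. dderiv j (f \<epsilon>) (w \<epsilon> x) * dderiv v (\<lambda>y. w \<epsilon> y \<bullet> j) x)) (at x)"
    if "0 < \<epsilon>" "\<epsilon> \<le> e" "x \<in> U" for \<epsilon> x
  proof -
    have f: "(f \<epsilon> has_derivative (\<lambda>v. dderiv v (f \<epsilon>) (w \<epsilon> x))) (at (w \<epsilon> x))"
      by (rule has_derivative_dderiv[OF f_diff[OF that]])
    have w: "(w \<epsilon> has_derivative (\<lambda>v. \<Sum>j\<in>Basis. dderiv v (\<lambda>y. w \<epsilon> y \<bullet> j) x *\<^sub>R j)) (at x)"
      by (rule has_derivative_componentwise_dderiv[OF w_diff[OF that]])
    have "linear (\<lambda>v. dderiv v (f \<epsilon>) (w \<epsilon> x))"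
      using f has_derivative_linear by blast
    note lin = linear_sum[OF this] linear_scale[OF this]
    have "dderiv (\<Sum>j\<in>Basis. dderiv v (\<lambda>y. w \<epsilon> y \<bullet> j) x *\<^sub>R j) (f \<epsilon>) (w \<epsilon> x) =
      (\<Sum>j\<in>Basis. dderiv j (f \<epsilon>) (w \<epsilon> x) * dderiv v (\<lambda>y. w \<epsilon> y \<bullet> j) x)" for v
      by (simp add: lin mult.commute)
    then show ?thesis
      using has_derivative_compose[OF w f] by (simp only:)
  qed
  have "moderate_upto e k U (\<lambda>\<epsilon>. dderiv v (\<lambda>x. f \<epsilon> (w \<epsilon> x)))" if v: "v \<in> Basis" for v
  proof (rule moderate_upto_cong[OF _ assms(1,2)])
    show "moderate_upto e k U (\<lambda>\<epsilon> x. \<Sum>j\<in>Basis. dderiv j (f \<epsilon>) (w \<epsilon> x) * dderiv v (\<lambda>y. w \<epsilon> y \<bullet> j) x)"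
    proof (rule moderate_upto_sum[OF assms(1,2)], rule moderate_upto_mult[OF assms(1,2)])
      fix j :: 'b assume j: "j \<in> Basis"
      show "moderate_upto e k U (\<lambda>\<epsilon> x. dderiv j (f \<epsilon>) (w \<epsilon> x))"
        by (rule Suc.IH[OF _ w]) (use Suc.prems(1) j in simp)
      show "moderate_upto e k U (\<lambda>\<epsilon>. dderiv v (\<lambda>y. w \<epsilon> y \<bullet> j))"
        using Suc.prems(2)[OF j] v by simp
    qed
    fix \<epsilon> x assume "0 < \<epsilon>" "\<epsilon> \<le> e" "x \<in> U"
    then show "(\<Sum>j\<in>Basis. dderiv j (f \<epsilon>) (w \<epsilon> x) * dderiv v (\<lambda>y. w \<epsilon> y \<bullet> j) x) = dderiv v (\<lambda>x. f \<epsilon> (w \<epsilon> x)) x"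
      using dderiv_eqI[OF der, of \<epsilon> x v] by simp
  qed
  moreover have "(\<lambda>x. f \<epsilon> (w \<epsilon> x)) differentiable (at x)" if "0 < \<epsilon>" "\<epsilon> \<le> e" "x \<in> U" for \<epsilon> x
    using der[OF that] unfolding differentiable_def by blast
  moreover have "moderate_bound U (\<lambda>\<epsilon> x. f \<epsilon> (w \<epsilon> x))"
    by (rule moderate_bound_compose[OF moderate_upto_bound[OF Suc.prems(1)] cb])
  ultimately show ?case by simp
qed

lemma moderate_upto_iter_deriv:
  assumes "moderate_upto e (length vs + k) U f" "vs \<in> lists Basis"
  shows "moderate_upto e k U (\<lambda>\<epsilon>. iter_deriv vs (f \<epsilon>))"
  using assms
proof (induction vs arbitrary: k)
  case (Cons v vs)
  then have "moderate_upto e (Suc k) U (\<lambda>\<epsilon>. iter_deriv vs (f \<epsilon>))"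
    using Cons.IH[of "Suc k"] by (simp del: moderate_upto.simps)
  then show ?case using Cons.prems by auto
qed auto

lemma moderate_uptoI:
  assumes "\<And>vs. vs \<in> lists Basis \<Longrightarrow> moderate_bound U (\<lambda>\<epsilon>. iter_deriv vs (f \<epsilon>))"
    and "\<And>vs \<epsilon> x. vs \<in> lists Basis \<Longrightarrow> 0 < \<epsilon> \<Longrightarrow> \<epsilon> \<le> e \<Longrightarrow> x \<in> U \<Longrightarrow> iter_deriv vs (f \<epsilon>) differentiable (at x)"
  shows "moderate_upto e k U f"
  using assms
proof (induction k arbitrary: f)
  case 0
  then show ?case using "0.prems"(1)[of "[]"] by simp
next
  case (Suc k)
  have "moderate_upto e k U (\<lambda>\<epsilon>. dderiv v (f \<epsilon>))" if "v \<in> Basis" for v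
  proof (rule Suc.IH)
    fix vs :: "'a list" assume "vs \<in> lists Basis"
    \<comment> \<open>\<open>moderate_upto\<close> peels off the innermost derivative, which sits at
      the end of the list in \<open>iter_deriv\<close>.\<close>
    then have "vs @ [v] \<in> lists Basis" using that by auto
    from Suc.prems(1)[OF this] Suc.prems(2)[OF this]
    show "moderate_bound U (\<lambda>\<epsilon>. iter_deriv vs (dderiv v (f \<epsilon>)))"
      and "\<And>\<epsilon> x. 0 < \<epsilon> \<Longrightarrow> \<epsilon> \<le> e \<Longrightarrow> x \<in> U \<Longrightarrow> iter_deriv vs (dderiv v (f \<epsilon>)) differentiable (at x)"
      by (simp_all add: iter_deriv_append)
  qed
  then show ?case using Suc.prems(1)[of "[]"] Suc.prems(2)[of "[]"] by auto
qed

lemma moderate_bound_iff_powr: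
  "moderate_bound U f \<longleftrightarrow> (\<forall>K. compact K \<and> K \<subseteq> U \<longrightarrow>
     (\<exists>N::nat. \<exists>C \<epsilon>0. \<epsilon>0 > 0 \<and> (\<forall>\<epsilon>. 0 < \<epsilon> \<and> \<epsilon> \<le> \<epsilon>0 \<and> \<epsilon> \<le> 1 \<longrightarrow>
          (\<forall>x\<in>K. \<bar>f \<epsilon> x\<bar> \<le> C * \<epsilon> powr (- real N)))))"
  (is "_ \<longleftrightarrow> ?R")
proof
  have powr: "\<epsilon> powr (- real N) = (1/\<epsilon>) ^ N" if "0 < \<epsilon>" for \<epsilon> :: real and N
    using that by (simp add: powr_minus powr_realpow power_one_over inverse_eq_divide)
  {
    assume f: "moderate_bound U f"
    show ?R
    proof (intro allI impI)
      fix K assume K: "compact K \<and> K \<subseteq> U"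
      then obtain N :: nat where "\<forall>\<^sub>F \<epsilon> in at_right 0. \<forall>x\<in>K. \<bar>f \<epsilon> x\<bar> \<le> (1/\<epsilon>) ^ N"
        using f K by (blast elim: moderate_boundE)
      then obtain d where d: "d > 0" "\<And>\<epsilon>. 0 < \<epsilon> \<Longrightarrow> \<epsilon> < d \<Longrightarrow> \<forall>x\<in>K. \<bar>f \<epsilon> x\<bar> \<le> (1/\<epsilon>) ^ N"
        by (auto simp: eventually_at_right_field)
      show "\<exists>N::nat. \<exists>C \<epsilon>0. \<epsilon>0 > 0 \<and> (\<forall>\<epsilon>. 0 < \<epsilon> \<and> \<epsilon> \<le> \<epsilon>0 \<and> \<epsilon> \<le> 1 \<longrightarrow>
          (\<forall>x\<in>K. \<bar>f \<epsilon> x\<bar> \<le> C * \<epsilon> powr (- real N)))"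
        \<comment> \<open>\<open>d/2\<close> turns the strict condition
          \<open>\<epsilon> < d\<close> into the non-strict one of the definition.\<close>
        using d by (intro exI[of _ N] exI[of _ 1] exI[of _ "d/2"]) (auto simp: powr)
    qed
  }
  {
    assume R: ?R
    show "moderate_bound U f"
    proof (rule moderate_boundI)
      fix K assume K: "compact K" "K \<subseteq> U"
      then obtain N :: nat and C \<epsilon>0 where *: "\<epsilon>0 > 0"
        "\<And>\<epsilon> x. 0 < \<epsilon> \<Longrightarrow> \<epsilon> \<le> \<epsilon>0 \<Longrightarrow> \<epsilon> \<le> 1 \<Longrightarrow> x \<in> K \<Longrightarrow> \<bar>f \<epsilon> x\<bar> \<le> C * \<epsilon> powr (- real N)"
        using R by meson
      then have "\<forall>\<^sub>F \<epsilon> in at_right 0. \<forall>x\<in>K. \<bar>f \<epsilon> x\<bar> \<le> C * (1/\<epsilon>) ^ N"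
        by (auto simp: eventually_at_right_field powr[symmetric] intro!: exI[of _ "min \<epsilon>0 1"])
      then show "\<exists>N::nat. \<exists>C. \<forall>\<^sub>F \<epsilon> in at_right 0. \<forall>x\<in>K. \<bar>f \<epsilon> x\<bar> \<le> C * (1/\<epsilon>) ^ N" by blast
    qed
  }
qed

text \<open>Trades the list encoding of multi-indices for a recursion on the order, so that closure
  properties can be proved by induction on \<open>k\<close>. The parameter \<open>1\<close> reflects
  that smoothness is demanded for every \<epsilon> in (0,1].\<close>

lemma moderate_iff_moderate_upto:
  "moderate U u \<longleftrightarrow> (\<forall>i\<in>Basis. \<forall>k. moderate_upto 1 k U (\<lambda>\<epsilon> x. u \<epsilon> x \<bullet> i))" (is "_ \<longleftrightarrow> ?R")
proof
  assume u: "moderate U u"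
  show ?R
  proof (intro ballI allI moderate_uptoI)
    fix i :: 'b and vs :: "'a list" assume "i \<in> Basis" "vs \<in> lists Basis"
    with u show "moderate_bound U (\<lambda>\<epsilon>. iter_deriv vs (\<lambda>x. u \<epsilon> x \<bullet> i))"
      unfolding moderate_def moderate_bound_iff_powr by meson
  next
    fix i :: 'b and vs :: "'a list" and \<epsilon> :: real and x
    assume "i \<in> Basis" "vs \<in> lists Basis" "0 < \<epsilon>" "\<epsilon> \<le> 1" "x \<in> U"
    with u show "iter_deriv vs (\<lambda>x. u \<epsilon> x \<bullet> i) differentiable (at x)"
      unfolding moderate_def vsmooth_on_def smooth_on_def by blast
  qed
next
  assume ?R
  \<comment> \<open>One spare order beyond \<open>vs\<close> gives both clauses of the definition:
    differentiability of the iterated derivative and its growth bound.\<close>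
  then have *: "moderate_upto 1 1 U (\<lambda>\<epsilon>. iter_deriv vs (\<lambda>x. u \<epsilon> x \<bullet> i))"
    if "i \<in> Basis" "vs \<in> lists Basis" for i vs
    using that by (intro moderate_upto_iter_deriv) (auto simp del: moderate_upto.simps)
  then have "moderate_bound U (\<lambda>\<epsilon>. iter_deriv vs (\<lambda>x. u \<epsilon> x \<bullet> i))"
    if "i \<in> Basis" "vs \<in> lists Basis" for i vs
    using that moderate_upto_bound by blast
  then show "moderate U u"
    unfolding moderate_def vsmooth_on_def smooth_on_def moderate_bound_iff_powr
    using * by auto
qed

lemma moderate_subset: "moderate U u \<Longrightarrow> V \<subseteq> U \<Longrightarrow> moderate V u"
  unfolding moderate_iff_moderate_upto by (blast intro: moderate_upto_subset)

lemma moderate_upto_imp_continuous_on: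
  assumes "moderate_upto e (Suc k) U f" "0 < \<epsilon>" "\<epsilon> \<le> e"
  shows "continuous_on U (f \<epsilon>)"
  using assms by (auto intro!: continuous_at_imp_continuous_on differentiable_imp_continuous_within)

lemma moderate_upto_compose_fixed:
  fixes w :: "'a::euclidean_space \<Rightarrow> 'b::euclidean_space"
  assumes "open U" "0 < e" "w ` U \<subseteq> V" "continuous_on U w"
    and "moderate_upto e k V f" "\<And>j. j \<in> Basis \<Longrightarrow> moderate_upto e k U (\<lambda>\<epsilon> x. w x \<bullet> j)"
  shows "moderate_upto e k U (\<lambda>\<epsilon> x. f \<epsilon> (w x))"
proof (rule moderate_upto_compose[OF assms(1,2) _ _ assms(5,6)])
  fix K assume K: "compact K" "K \<subseteq> U"
  then have "compact (w ` K)" "w ` K \<subseteq> V"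
    using assms(3,4) by (auto intro: compact_continuous_image continuous_on_subset)
  then show "\<exists>L. compact L \<and> L \<subseteq> V \<and> (\<forall>\<^sub>F \<epsilon> in at_right (0::real). w ` K \<subseteq> L)"
    by auto
qed (use assms(3) in auto)

lemma moderate_upto_diff:
  assumes "open U" "0 < e" "moderate_upto e k U f" "moderate_upto e k U g"
  shows "moderate_upto e k U (\<lambda>\<epsilon> x. f \<epsilon> x - g \<epsilon> x)"
proof -
  have "moderate_upto e k U (\<lambda>\<epsilon> x. f \<epsilon> x + (-1) * g \<epsilon> x)"
    using assms by (intro moderate_upto_add moderate_upto_mult moderate_upto_const)
  then show ?thesis by simp
qed

lemma moderate_imp_continuous_on:
  assumes "moderate U u" "0 < \<epsilon>" "\<epsilon> \<le> 1"
  shows "continuous_on U (u \<epsilon>)"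
  unfolding continuous_on_componentwise[of _ "u \<epsilon>"]
proof
  fix i :: 'b assume "i \<in> Basis"
  then have "moderate_upto 1 (Suc 0) U (\<lambda>\<epsilon> x. u \<epsilon> x \<bullet> i)"
    using assms(1) unfolding moderate_iff_moderate_upto by blast
  from moderate_upto_imp_continuous_on[OF this assms(2,3)]
  show "continuous_on U (\<lambda>x. u \<epsilon> x \<bullet> i)" .
qed

subsection \<open>Nets in G(U)\<close>

text \<open>Inverses exist only for \<epsilon> up to some \<open>e\<close>, whereas
  \<open>moderate\<close> asks for smooth maps for all \<epsilon> in (0,1]. A constant fills the
  gap, and the growth bounds do not notice it because they concern small \<epsilon>.\<close>

lemma moderate_upto_extend_const:
  assumes "0 < e" "moderate_upto e k U f"
  shows "moderate_upto e' k U (\<lambda>\<epsilon> x. if \<epsilon> \<le> e then f \<epsilon> x else c)"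
  using assms(2)
proof (induction k arbitrary: f c)
  case 0
  then have "moderate_bound U f" by simp
  then have "moderate_bound U (\<lambda>\<epsilon> x. if \<epsilon> \<le> e then f \<epsilon> x else c)"
    by (rule moderate_bound_cong) (use assms(1) in auto)
  then show ?case by simp
next
  case (Suc k)
  have "moderate_bound U (\<lambda>\<epsilon> x. if \<epsilon> \<le> e then f \<epsilon> x else c)"
    by (rule moderate_bound_cong[OF moderate_upto_bound[OF Suc.prems]]) (use assms(1) in auto)
  moreover have "moderate_upto e' k U (\<lambda>\<epsilon>. dderiv v (\<lambda>x. if \<epsilon> \<le> e then f \<epsilon> x else c))"
    if "v \<in> Basis" for v
  proof -
    have "moderate_upto e' k U (\<lambda>\<epsilon> x. if \<epsilon> \<le> e then dderiv v (f \<epsilon>) x else 0)"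
      by (rule Suc.IH) (use Suc.prems that in simp)
    moreover have "(\<lambda>\<epsilon> x. if \<epsilon> \<le> e then dderiv v (f \<epsilon>) x else 0) =
        (\<lambda>\<epsilon>. dderiv v (\<lambda>x. if \<epsilon> \<le> e then f \<epsilon> x else c))"
      by (intro ext) simp
    ultimately show ?thesis by simp
  qed
  moreover have "(\<lambda>x. if \<epsilon> \<le> e then f \<epsilon> x else c) differentiable (at x)" if "0 < \<epsilon>" "x \<in> U" for \<epsilon> x
    using Suc.prems that by (cases "\<epsilon> \<le> e") auto
  ultimately show ?case by simp
qed

text \<open>On an open set all iterated derivatives vanish together with the map. Both inversion
  identities below are proved as exact equalities for small \<epsilon> and pass through this
  rule.\<close>

lemma negligible_net_eventually_zero:
  assumes "open U" "0 < e" "\<And>\<epsilon> x. 0 < \<epsilon> \<Longrightarrow> \<epsilon> \<le> e \<Longrightarrow> x \<in> U \<Longrightarrow> u \<epsilon> x = 0"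
  shows "negligible_net U u"
  unfolding negligible_net_def
proof (intro allI impI ballI)
  fix K :: "'a set" and vs :: "'a list" and i :: 'b and m :: nat
  assume K: "compact K \<and> K \<subseteq> U"
  have "iter_deriv vs (\<lambda>y. u \<epsilon> y \<bullet> i) x = 0" if "0 < \<epsilon>" "\<epsilon> \<le> e" "x \<in> U" for \<epsilon> x
    using iter_deriv_cong_open[OF assms(1), of "\<lambda>y. u \<epsilon> y \<bullet> i" "\<lambda>y. 0" x vs] assms(3) that
    by (simp add: iter_deriv_const)
  then show "\<exists>C \<epsilon>0. 0 < \<epsilon>0 \<and> (\<forall>\<epsilon>. 0 < \<epsilon> \<and> \<epsilon> \<le> \<epsilon>0 \<and> \<epsilon> \<le> 1 \<longrightarrow>
      (\<forall>x\<in>K. \<bar>iter_deriv vs (\<lambda>y. u \<epsilon> y \<bullet> i) x\<bar> \<le> C * \<epsilon> ^ m))"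
    using K assms(2) by (intro exI[of _ 0] exI[of _ e]) auto
qed

lemma gequiv_refl: "gequiv U u u"
  by (auto simp: gequiv_def negligible_net_def iter_deriv_const intro!: exI[of _ 0] exI[of _ 1])

lemma cbounded_netI:
  assumes "moderate U u" "0 < e"
    and "\<And>K. compact K \<Longrightarrow> K \<subseteq> U \<Longrightarrow>
      \<exists>L. compact L \<and> L \<subseteq> V \<and> (\<forall>\<epsilon>. 0 < \<epsilon> \<and> \<epsilon> \<le> e \<longrightarrow> u \<epsilon> ` K \<subseteq> L)"
  shows "cbounded_net U V u"
  unfolding cbounded_net_def using assms by meson

subsection \<open>Inverses of moderate nets\<close>

lemma moderate_upto_ldet:
  fixes f :: "real \<Rightarrow> 'a::euclidean_space \<Rightarrow> 'b::euclidean_space \<Rightarrow> 'b"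
  assumes "open U" "0 < e"
    and "\<And>b i. b \<in> Basis \<Longrightarrow> i \<in> Basis \<Longrightarrow> moderate_upto e k U (\<lambda>\<epsilon> x. f \<epsilon> x b \<bullet> i)"
  shows "moderate_upto e k U (\<lambda>\<epsilon> x. ldet (f \<epsilon> x))"
  unfolding ldet_def
  by (intro moderate_upto_sum moderate_upto_mult moderate_upto_prod moderate_upto_const assms)
    (auto simp: permutes_in_image)

text \<open>\<open>w \<epsilon>\<close> is given only as a set-theoretic section of
  \<open>t \<epsilon>\<close> over \<open>Y\<close>, so its differentiability is part of the claim.
  The induction starts because order zero is contained in the c-boundedness \<open>cb\<close>; it
  advances because the derivative of \<open>w\<close> at \<open>y\<close> involves \<open>w\<close>
  only undifferentiated, so order \<open>k\<close> of \<open>w\<close> yields order \<open>k\<close>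
  of its derivatives.\<close>

lemma moderate_upto_local_inverse:
  fixes t w :: "real \<Rightarrow> 'a::euclidean_space \<Rightarrow> 'a"
  assumes e: "0 < e" and \<Omega>: "open \<Omega>" and Y: "open Y"
    and t: "\<And>k j. j \<in> Basis \<Longrightarrow> moderate_upto e k \<Omega> (\<lambda>\<epsilon> x. t \<epsilon> x \<bullet> j)"
    and inj: "\<And>\<epsilon>. 0 < \<epsilon> \<Longrightarrow> \<epsilon> \<le> e \<Longrightarrow> inj_on (t \<epsilon>) \<Omega>"
    and C: "0 < C"
    and det: "\<And>\<epsilon> p. 0 < \<epsilon> \<Longrightarrow> \<epsilon> \<le> e \<Longrightarrow> p \<in> \<Omega> \<Longrightarrow> C * \<epsilon> ^ N \<le> \<bar>ldet (frechet_derivative (t \<epsilon>) (at p))\<bar>"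
    and w: "\<And>\<epsilon> y. 0 < \<epsilon> \<Longrightarrow> \<epsilon> \<le> e \<Longrightarrow> y \<in> Y \<Longrightarrow> w \<epsilon> y \<in> \<Omega> \<and> t \<epsilon> (w \<epsilon> y) = y"
    and cb: "\<And>K. compact K \<Longrightarrow> K \<subseteq> Y \<Longrightarrow>
      \<exists>L. compact L \<and> L \<subseteq> \<Omega> \<and> (\<forall>\<^sub>F \<epsilon> in at_right 0. w \<epsilon> ` K \<subseteq> L)"
    and j: "j \<in> Basis"
  shows "moderate_upto e k Y (\<lambda>\<epsilon> y. w \<epsilon> y \<bullet> j)"
  using j
proof (induction k arbitrary: j)
  case (0 j)
  have "moderate_bound \<Omega> (\<lambda>\<epsilon> x. x \<bullet> j)"
    by (intro moderate_bound_continuous continuous_intros)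
  from moderate_bound_compose[OF this cb] show ?case by simp
next
  case (Suc k j)
  define Dt where "Dt \<epsilon> p = frechet_derivative (t \<epsilon>) (at p)" for \<epsilon> p
  have t_diff: "t \<epsilon> differentiable (at p)" if "0 < \<epsilon>" "\<epsilon> \<le> e" "p \<in> \<Omega>" for \<epsilon> p
  proof -
    have "(\<lambda>x. t \<epsilon> x \<bullet> i) differentiable (at p)" if "i \<in> Basis" for i
      using t[OF that, of 1] \<open>0 < \<epsilon>\<close> \<open>\<epsilon> \<le> e\<close> \<open>p \<in> \<Omega>\<close> by simp
    then show ?thesis
      by (rule differentiableI[OF has_derivative_componentwise_dderiv])
  qed
  have t_deriv: "(t \<epsilon> has_derivative Dt \<epsilon> p) (at p)" if "0 < \<epsilon>" "\<epsilon> \<le> e" "p \<in> \<Omega>" for \<epsilon> p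
    using t_diff[OF that] unfolding Dt_def frechet_derivative_works .
  have lin: "linear (Dt \<epsilon> p)" if "0 < \<epsilon>" "\<epsilon> \<le> e" "p \<in> \<Omega>" for \<epsilon> p
    using t_deriv[OF that] by (rule has_derivative_linear)
  have ldet_nz: "ldet (Dt \<epsilon> p) \<noteq> 0" if "0 < \<epsilon>" "\<epsilon> \<le> e" "p \<in> \<Omega>" for \<epsilon> p
  proof -
    have "0 < C * \<epsilon> ^ N" using C that by simp
    with det[OF that] show ?thesis unfolding Dt_def by linarith
  qed
  have Dt_mod: "moderate_upto e l \<Omega> (\<lambda>\<epsilon> p. Dt \<epsilon> p b \<bullet> i)" if "b \<in> Basis" "i \<in> Basis" for l b i
  proof (rule moderate_upto_cong[OF _ \<Omega> e])
    show "moderate_upto e l \<Omega> (\<lambda>\<epsilon>. dderiv b (\<lambda>x. t \<epsilon> x \<bullet> i))"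
      using t[OF that(2), of "Suc l"] that(1) by simp
    fix \<epsilon> p assume "0 < \<epsilon>" "\<epsilon> \<le> e" "p \<in> \<Omega>"
    from t_deriv[OF this] show "dderiv b (\<lambda>x. t \<epsilon> x \<bullet> i) p = Dt \<epsilon> p b \<bullet> i"
      by (intro dderiv_eqI has_derivative_inner_left)
  qed
  have ldet_mod: "moderate_upto e l \<Omega> (\<lambda>\<epsilon> p. ldet (Dt \<epsilon> p))" for l
    by (rule moderate_upto_ldet[OF \<Omega> e Dt_mod])
  \<comment> \<open>The hypothesis \<open>det\<close> enters twice: above as non-vanishing, here as
    the order-zero bound on the reciprocal that \<open>moderate_upto_inverse\<close> asks
    for.\<close>
  have ldet_bound: "moderate_bound \<Omega> (\<lambda>\<epsilon> p. inverse (ldet (Dt \<epsilon> p)))"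
  proof (rule moderate_boundI)
    fix K assume K: "compact K" "K \<subseteq> \<Omega>"
    have "\<forall>\<^sub>F \<epsilon> in at_right 0. 0 < \<epsilon> \<and> \<epsilon> < e"
      using e by (auto simp: eventually_at_right_field)
    then have "\<forall>\<^sub>F \<epsilon> in at_right 0. \<forall>p\<in>K. \<bar>inverse (ldet (Dt \<epsilon> p))\<bar> \<le> inverse C * (1/\<epsilon>) ^ N"
    proof eventually_elim
      case (elim \<epsilon>)
      show ?case
      proof
        fix p assume "p \<in> K"
        then have "C * \<epsilon> ^ N \<le> \<bar>ldet (Dt \<epsilon> p)\<bar>"
          using det[of \<epsilon> p] elim K unfolding Dt_def by auto
        then have "inverse \<bar>ldet (Dt \<epsilon> p)\<bar> \<le> inverse (C * \<epsilon> ^ N)"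
          using C elim by (intro le_imp_inverse_le) auto
        then show "\<bar>inverse (ldet (Dt \<epsilon> p))\<bar> \<le> inverse C * (1/\<epsilon>) ^ N"
          by (simp add: abs_inverse power_one_over inverse_eq_divide)
      qed
    qed
    then show "\<exists>N::nat. \<exists>C. \<forall>\<^sub>F \<epsilon> in at_right 0. \<forall>p\<in>K. \<bar>inverse (ldet (Dt \<epsilon> p))\<bar> \<le> C * (1/\<epsilon>) ^ N"
      by blast
  qed
  \<comment> \<open>By Cramer's rule, this is the \<open>j\<close>-th component of \<open>(Dt \<epsilon> p)\<^sup>-\<^sup>1 v\<close>.\<close>
  define G where "G v \<epsilon> p = ldet ((Dt \<epsilon> p)(j := v)) * inverse (ldet (Dt \<epsilon> p))" for v \<epsilon> p
  have G_mod: "moderate_upto e l \<Omega> (G v)" for l v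
  proof -
    have "moderate_upto e l \<Omega> (\<lambda>\<epsilon> p. ldet ((Dt \<epsilon> p)(j := v)))"
    proof (rule moderate_upto_ldet[OF \<Omega> e])
      fix b i :: 'a assume "b \<in> Basis" "i \<in> Basis"
      then show "moderate_upto e l \<Omega> (\<lambda>\<epsilon> p. ((Dt \<epsilon> p)(j := v)) b \<bullet> i)"
        using Dt_mod moderate_upto_const by (cases "b = j") auto
    qed
    then show ?thesis
      unfolding G_def using ldet_mod ldet_nz ldet_bound
      by (intro moderate_upto_mult[OF \<Omega> e] moderate_upto_inverse[OF \<Omega> e])
  qed
  have w_deriv: "((\<lambda>y. w \<epsilon> y \<bullet> j) has_derivative (\<lambda>v. G v \<epsilon> (w \<epsilon> y))) (at y)"
    if \<epsilon>: "0 < \<epsilon>" "\<epsilon> \<le> e" and y: "y \<in> Y" for \<epsilon> y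
  proof -
    let ?p = "w \<epsilon> y"
    have p: "?p \<in> \<Omega>" "t \<epsilon> ?p = y" using w[OF \<epsilon> y] by auto
    note L = lin[OF \<epsilon> p(1)] ldet_nz[OF \<epsilon> p(1)]
    obtain P where P: "linear P" "P \<circ> Dt \<epsilon> ?p = id" "Dt \<epsilon> ?p \<circ> P = id"
      using linear_injective_isomorphism[OF L(1) ldet_nonzero_imp_inj[OF L]] by (auto simp: fun_eq_iff)
    \<comment> \<open>The inverse function rule wants a left inverse on all of
      \<open>\<Omega>\<close>, while \<open>w \<epsilon>\<close> is a right inverse over
      \<open>Y\<close>. The derivative is computed for \<open>inv_into\<close> and carried over to
      \<open>w \<epsilon>\<close> on the open set \<open>Y\<close>, where injectivity makes the two
      agree.\<close>
    let ?g = "inv_into \<Omega> (t \<epsilon>)"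
    have "continuous_on \<Omega> (t \<epsilon>)"
      using t_diff[OF \<epsilon>] by (intro continuous_at_imp_continuous_on ballI differentiable_imp_continuous_within)
    then have "(?g has_derivative P) (at (t \<epsilon> ?p))"
      by (rule has_derivative_inverse_strong[OF \<Omega> p(1) _ inv_into_f_f[OF inj[OF \<epsilon>]] t_deriv[OF \<epsilon> p(1)] P(3)])
    then have "(?g has_derivative P) (at y)" by (simp add: p)
    moreover have "?g z = w \<epsilon> z" if "z \<in> Y" for z
      using w[OF \<epsilon> that] inv_into_f_f[OF inj[OF \<epsilon>], of "w \<epsilon> z"] by simp
    ultimately have "(w \<epsilon> has_derivative P) (at y)"
      by (rule has_derivative_transform_within_open[OF _ Y y])
    then have "((\<lambda>y. w \<epsilon> y \<bullet> j) has_derivative (\<lambda>v. P v \<bullet> j)) (at y)"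
      by (rule has_derivative_inner_left)
    moreover have "P v \<bullet> j = G v \<epsilon> ?p" for v
    proof -
      have "Dt \<epsilon> ?p (P v) = v" using P(3) by (simp add: fun_eq_iff)
      then show ?thesis
        using ldet_Cramer[OF L(1) Suc.prems, of "P v"] L(2) by (simp add: G_def)
    qed
    ultimately show ?thesis by simp
  qed
  have "moderate_upto e k Y (\<lambda>\<epsilon>. dderiv v (\<lambda>y. w \<epsilon> y \<bullet> j))" for v
  proof (rule moderate_upto_cong[OF _ Y e])
    show "moderate_upto e k Y (\<lambda>\<epsilon> y. G v \<epsilon> (w \<epsilon> y))"
      by (rule moderate_upto_compose[OF Y e _ cb G_mod Suc.IH]) (use w in auto)
    fix \<epsilon> y assume "0 < \<epsilon>" "\<epsilon> \<le> e" "y \<in> Y"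
    from dderiv_eqI[OF w_deriv[OF this]] show "G v \<epsilon> (w \<epsilon> y) = dderiv v (\<lambda>y. w \<epsilon> y \<bullet> j) y" by simp
  qed
  moreover have "(\<lambda>y. w \<epsilon> y \<bullet> j) differentiable (at y)" if "0 < \<epsilon>" "\<epsilon> \<le> e" "y \<in> Y" for \<epsilon> y
    using w_deriv[OF that] by (rule differentiableI)
  moreover have "moderate_bound Y (\<lambda>\<epsilon> y. w \<epsilon> y \<bullet> j)"
    using moderate_upto_bound[OF Suc.IH[OF Suc.prems]] .
  ultimately show ?case by simp
qed

subsection \<open>Images of almost equal maps\<close>

text \<open>The trace on \<open>ball y d\<close> of the image of the open ball is open by invariance
  of domain. It is also closed there: the image of the sphere misses \<open>ball y d\<close>, so the
  compact image of the closed ball has the same trace. It contains \<open>f q\<close>, so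
  connectedness of \<open>ball y d\<close> makes it everything.\<close>

lemma ball_subset_injective_image:
  fixes f :: "'a::euclidean_space \<Rightarrow> 'a"
  assumes cont: "continuous_on (cball q r) f" and inj: "inj_on f (ball q r)"
    and sphere: "\<And>x. x \<in> sphere q r \<Longrightarrow> d \<le> dist y (f x)"
    and centre: "dist y (f q) < d" and r: "0 < r"
  shows "ball y d \<subseteq> f ` ball q r"
proof -
  have "open (f ` ball q r)"
    using cont inj by (intro invariance_of_domain) (auto intro: continuous_on_subset)
  moreover have "closed (f ` cball q r)"
    using cont by (intro compact_imp_closed compact_continuous_image) auto
  moreover have "ball y d \<inter> f ` cball q r = ball y d \<inter> f ` ball q r"
  proof -
    have "ball y d \<inter> f ` sphere q r = {}" using sphere by force
    moreover have "cball q r = ball q r \<union> sphere q r" by auto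
    ultimately show ?thesis by blast
  qed
  ultimately have "openin (top_of_set (ball y d)) (ball y d \<inter> f ` ball q r)"
    "closedin (top_of_set (ball y d)) (ball y d \<inter> f ` ball q r)"
    by (metis openin_open_Int, metis closedin_closed_Int)
  moreover have "f q \<in> ball y d \<inter> f ` ball q r"
    using centre r by auto
  ultimately have "ball y d \<inter> f ` ball q r = ball y d"
    using convex_connected[OF convex_ball, of y d] unfolding connected_clopen by blast
  then show ?thesis by blast
qed

lemma ball_subset_images_of_approximations:
  fixes \<phi> :: "'a::euclidean_space \<Rightarrow> 'a" and \<psi> :: "real \<Rightarrow> 'a \<Rightarrow> 'a"
  assumes r: "0 < r" and \<phi>: "continuous_on (cball q r) \<phi>" "inj_on \<phi> (cball q r)"
    and conv: "\<And>d. 0 < d \<Longrightarrow> \<forall>\<^sub>F \<epsilon> in at_right 0. \<forall>x\<in>cball q r. dist (\<psi> \<epsilon> x) (\<phi> x) < d"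
    and cont: "\<forall>\<^sub>F \<epsilon> in at_right 0. continuous_on (cball q r) (\<psi> \<epsilon>) \<and> inj_on (\<psi> \<epsilon>) (cball q r)"
  obtains d where "0 < d" "\<forall>\<^sub>F \<epsilon> in at_right 0. ball (\<phi> q) d \<subseteq> \<psi> \<epsilon> ` ball q r"
proof -
  have "compact (\<phi> ` sphere q r)"
    using \<phi>(1) by (intro compact_continuous_image) (auto intro: continuous_on_subset)
  moreover have "\<phi> q \<notin> \<phi> ` sphere q r"
    using inj_onD[OF \<phi>(2)] r by (auto simp: sphere_def cball_def)
  ultimately obtain d where d: "0 < d" "\<And>y. y \<in> \<phi> ` sphere q r \<Longrightarrow> d \<le> dist (\<phi> q) y"
    using separate_point_closed[of "\<phi> ` sphere q r" "\<phi> q"] compact_imp_closed by blast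
  \<comment> \<open>A perturbation below \<open>d/2\<close> leaves the image of the sphere at
    distance at least \<open>d/2\<close> from \<open>\<phi> q\<close>, and keeps the image of the
    centre within \<open>d/2\<close>.\<close>
  have "\<forall>\<^sub>F \<epsilon> in at_right 0. ball (\<phi> q) (d/2) \<subseteq> \<psi> \<epsilon> ` ball q r"
    using conv[OF half_gt_zero[OF d(1)]] cont
  proof eventually_elim
    case (elim \<epsilon>)
    show ?case
    proof (rule ball_subset_injective_image[OF _ _ _ _ r])
      show "d / 2 \<le> dist (\<phi> q) (\<psi> \<epsilon> x)" if "x \<in> sphere q r" for x
      proof -
        have "dist (\<psi> \<epsilon> x) (\<phi> x) < d / 2" "d \<le> dist (\<phi> q) (\<phi> x)"
          using elim d that by auto
        then show ?thesis using dist_triangle[of "\<phi> q" "\<phi> x" "\<psi> \<epsilon> x"] by simp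
      qed
      show "dist (\<phi> q) (\<psi> \<epsilon> q) < d / 2"
        using elim r by (simp add: dist_commute)
    qed (use elim in \<open>auto intro: inj_on_subset\<close>)
  qed
  then show thesis using that[of "d/2"] d by simp
qed

subsection \<open>Smooth cutoff\<close>

text \<open>The classical flat function \<open>exp (-1/x)\<close> is \<open>flat 0\<close>. The
  weights \<open>inverse x ^ m\<close> are included so that the family is closed under
  differentiation up to linear combinations; smoothness then needs only an induction over the
  family.\<close>

definition flat :: "nat \<Rightarrow> real \<Rightarrow> real" where
  "flat m x = (if 0 < x then exp (- inverse x) * inverse x ^ m else 0)"

lemma flat_tendsto_0: "(flat m \<longlongrightarrow> 0) (at 0)"
proof (rule filterlim_split_at)
  show "(flat m \<longlongrightarrow> 0) (at_left 0)"
    by (rule tendsto_eventually) (auto simp: flat_def eventually_at_left_field intro!: exI[of _ "-1"])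
  have "((\<lambda>x::real. exp (- inverse x) * inverse x ^ m) \<longlongrightarrow> 0) (at_right 0)"
    by real_asymp
  then show "(flat m \<longlongrightarrow> 0) (at_right 0)"
    by (rule Lim_transform_eventually) (auto simp: flat_def eventually_at_right_field intro!: exI[of _ 1])
qed

lemma flat_DERIV:
  "(flat m has_real_derivative flat (m + 2) x - real m * flat (m + 1) x) (at x)"
proof -
  consider "x < 0" | "x = 0" | "0 < x" by linarith
  then show ?thesis
  proof cases
    assume x: "x < 0"
    have "((\<lambda>x. 0) has_real_derivative 0) (at x)" by simp
    then have "(flat m has_real_derivative 0) (at x)"
      by (rule has_field_derivative_transform_within_open[of _ _ _ "{..<0}"]) (use x in \<open>auto simp: flat_def\<close>)
    with x show ?thesis by (simp add: flat_def)
  next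
    assume x: "x = 0"
    \<comment> \<open>At the origin the difference quotient of \<open>flat m\<close> is again a
      member of the family, \<open>flat (Suc m)\<close>.\<close>
    have "((\<lambda>h. (flat m (0 + h) - flat m 0) / h) \<longlongrightarrow> 0) (at 0)"
      by (rule Lim_transform_eventually[OF flat_tendsto_0[of "Suc m"]])
        (auto simp: flat_def divide_inverse eventually_at_filter)
    then have "(flat m has_real_derivative 0) (at 0)"
      by (simp add: DERIV_def)
    with x show ?thesis by (simp add: flat_def)
  next
    assume x: "0 < x"
    have "((\<lambda>x. exp (- inverse x) * inverse x ^ m) has_real_derivative
        exp (- inverse x) * inverse x ^ (m + 2) - real m * (exp (- inverse x) * inverse x ^ (m + 1))) (at x)"
      using x
      by (intro DERIV_cong[OF DERIV_mult[OF DERIV_fun_exp[OF DERIV_minus[OF DERIV_inverse]] DERIV_power[OF DERIV_inverse]]])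
        (cases m; simp add: algebra_simps)+
    then have "(flat m has_real_derivative
        exp (- inverse x) * inverse x ^ (m + 2) - real m * (exp (- inverse x) * inverse x ^ (m + 1))) (at x)"
      by (rule has_field_derivative_transform_within_open[of _ _ _ "{0<..}"]) (use x in \<open>auto simp: flat_def\<close>)
    with x show ?thesis by (simp add: flat_def)
  qed
qed

lemma continuous_on_flat: "continuous_on S (flat m)"
  by (intro continuous_at_imp_continuous_on ballI DERIV_isCont[OF flat_DERIV])

text \<open>Moderateness of a net that does not depend on \<epsilon> plays the role of smoothness
  here, so the closure rules proved for nets also serve to build the cutoff.\<close>

lemma moderate_upto_flat: "0 < e \<Longrightarrow> moderate_upto e k UNIV (\<lambda>\<epsilon>. flat m)"
proof (induction k arbitrary: m)
  case 0
  show ?case by (simp add: moderate_bound_continuous continuous_on_flat)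
next
  case (Suc k)
  have diff: "flat m differentiable (at x)" for x
    using flat_DERIV[of m x] unfolding has_field_derivative_def by (rule differentiableI)
  have "dderiv v (flat m) = (\<lambda>x. (flat (m + 2) x - real m * flat (m + 1) x) * v)" for v
    by (intro ext dderiv_eqI flat_DERIV[unfolded has_field_derivative_def])
  moreover have "moderate_upto e k UNIV (\<lambda>\<epsilon> x. (flat (m + 2) x - real m * flat (m + 1) x) * v)" for v
    by (intro moderate_upto_mult moderate_upto_diff moderate_upto_const Suc.IH Suc.prems open_UNIV)
  ultimately have "moderate_upto e k UNIV (\<lambda>\<epsilon>. dderiv v (flat m))" for v
    by (simp only:)
  with diff show ?case
    unfolding moderate_upto.simps using moderate_bound_continuous[OF continuous_on_flat] by blast
qed

text \<open>The thresholds 1 and 4 are the squares of 1 and 2: the argument will be a gauge that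
  scales quadratically, so the transition takes place between an ellipsoid and its double. At every
  point at least one of the two summands of the denominator is positive.\<close>

definition cutoff :: "real \<Rightarrow> real" where
  "cutoff s = flat 0 (4 - s) * inverse (flat 0 (4 - s) + flat 0 (s - 1))"

lemma cutoff_denominator_pos: "0 < flat 0 (4 - s) + flat 0 (s - 1)"
  by (auto simp: flat_def add_pos_pos)

lemma cutoff_bounds: "0 \<le> cutoff s" "cutoff s \<le> 1"
  using cutoff_denominator_pos[of s] by (auto simp: cutoff_def flat_def field_simps)

lemma cutoff_eq_1: "s \<le> 1 \<Longrightarrow> cutoff s = 1"
  using cutoff_denominator_pos[of s] by (auto simp: cutoff_def flat_def)

lemma cutoff_eq_0: "4 \<le> s \<Longrightarrow> cutoff s = 0"
  by (auto simp: cutoff_def flat_def)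

lemma moderate_upto_cutoff:
  assumes "0 < e"
  shows "moderate_upto e k UNIV (\<lambda>\<epsilon>. cutoff)"
proof -
  have *: "moderate_upto e k UNIV (\<lambda>\<epsilon> x. flat 0 (x \<bullet> c + d))" for c d :: real
  proof (rule moderate_upto_compose_fixed[OF _ assms _ _ moderate_upto_flat[OF assms]])
    fix j :: real assume "j \<in> Basis"
    moreover have "moderate_upto e k UNIV (\<lambda>\<epsilon> x. x \<bullet> c + d)"
      by (intro moderate_upto_add moderate_upto_inner moderate_upto_const assms open_UNIV)
    ultimately show "moderate_upto e k UNIV (\<lambda>\<epsilon> x. (x \<bullet> c + d) \<bullet> j)"
      by simp
  qed (auto intro!: continuous_intros)
  have 1: "moderate_upto e k UNIV (\<lambda>\<epsilon> x. flat 0 (4 - x))"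
    using *[of "-1" 4] by simp
  have 2: "moderate_upto e k UNIV (\<lambda>\<epsilon> x. flat 0 (x - 1))"
    using *[of 1 "-1"] by simp
  have nz: "flat 0 (4 - s) + flat 0 (s - 1) \<noteq> 0" for s
    using cutoff_denominator_pos[of s] by simp
  have "continuous_on UNIV (\<lambda>x. inverse (flat 0 (4 - x) + flat 0 (x - 1)))"
    using nz by (intro continuous_intros continuous_on_compose2[OF continuous_on_flat[of UNIV]]) auto
  then show ?thesis
    unfolding cutoff_def
    by (intro moderate_upto_mult moderate_upto_inverse moderate_upto_add moderate_bound_continuous
        1 2 assms nz open_UNIV)
qed

text \<open>The map pulls \<open>z\<close> towards \<open>z0\<close> by a factor in [0,1]. Where the
  gauge exceeds 4 the factor is 0 and the point collapses to \<open>z0\<close>; elsewhere quadratic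
  scaling shows that the gauge does not grow. The range is thus confined without any estimate on the
  transition zone.\<close>

lemma smooth_truncation:
  fixes Q :: "'a::euclidean_space \<Rightarrow> real" and z0 :: 'a
  assumes e: "0 < e" and Q: "\<And>k. moderate_upto e k UNIV (\<lambda>\<epsilon>. Q)"
    and Q_nonneg: "\<And>z. 0 \<le> Q z" and Q_scale: "\<And>c z. Q (c *\<^sub>R z) = c\<^sup>2 * Q z"
  obtains \<rho> :: "'a \<Rightarrow> 'a" where "continuous_on UNIV \<rho>"
    "\<And>k j. j \<in> Basis \<Longrightarrow> moderate_upto e k UNIV (\<lambda>\<epsilon> z. \<rho> z \<bullet> j)"
    "\<And>z. Q (z - z0) \<le> 1 \<Longrightarrow> \<rho> z = z"
    "\<And>z. Q (\<rho> z - z0) \<le> 4"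
proof -
  define \<rho> where "\<rho> z = z0 + cutoff (Q (z - z0)) *\<^sub>R (z - z0)" for z
  have shift: "moderate_upto e k UNIV (\<lambda>\<epsilon> z. (z - z0) \<bullet> j)" for j :: 'a and k
  proof -
    have "moderate_upto e k UNIV (\<lambda>\<epsilon> z. z \<bullet> j - z0 \<bullet> j)"
      using e by (intro moderate_upto_diff moderate_upto_inner moderate_upto_const) auto
    then show ?thesis by (simp add: inner_diff_left)
  qed
  have Qs: "moderate_upto e k UNIV (\<lambda>\<epsilon> z. Q (z - z0))" for k
    using shift by (intro moderate_upto_compose_fixed[OF _ e _ _ Q]) (auto intro!: continuous_intros)
  have "continuous_on UNIV (\<lambda>z. Q (z - z0))"
    using moderate_upto_imp_continuous_on[OF Qs e] by simp
  then have chi: "moderate_upto e k UNIV (\<lambda>\<epsilon> z. cutoff (Q (z - z0)))" for k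
  proof (intro moderate_upto_compose_fixed[OF _ e _ _ moderate_upto_cutoff[OF e]])
    fix j :: real assume "j \<in> Basis"
    then show "moderate_upto e k UNIV (\<lambda>\<epsilon> z. Q (z - z0) \<bullet> j)" using Qs by simp
  qed auto
  have m: "moderate_upto e k UNIV (\<lambda>\<epsilon> z. \<rho> z \<bullet> j)" for k j
  proof -
    have "moderate_upto e k UNIV (\<lambda>\<epsilon> z. z0 \<bullet> j + cutoff (Q (z - z0)) * ((z - z0) \<bullet> j))"
      using e chi shift by (intro moderate_upto_add moderate_upto_mult moderate_upto_const) auto
    then show ?thesis by (simp add: \<rho>_def inner_add_left)
  qed
  show thesis
  proof (rule that[of \<rho>])
    show "continuous_on UNIV \<rho>"
      unfolding continuous_on_componentwise[of _ \<rho>]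
      using moderate_upto_imp_continuous_on[OF m e] by blast
    show "moderate_upto e k UNIV (\<lambda>\<epsilon> z. \<rho> z \<bullet> j)" for k j by (rule m)
    show "\<rho> z = z" if "Q (z - z0) \<le> 1" for z
      using that by (simp add: \<rho>_def cutoff_eq_1)
    show "Q (\<rho> z - z0) \<le> 4" for z
    proof (cases "Q (z - z0) \<le> 4")
      case True
      have "(cutoff (Q (z - z0)))\<^sup>2 * Q (z - z0) \<le> 1 * Q (z - z0)"
        using cutoff_bounds Q_nonneg by (intro mult_right_mono power_le_one) auto
      then show ?thesis using True by (simp add: \<rho>_def Q_scale)
    \<comment> \<open>Here \<open>\<rho> z = z0\<close>, and scaling by 0 gives
      \<open>Q 0 = 0\<close>.\<close>
    qed (use Q_scale[of 0 0] in \<open>simp add: \<rho>_def cutoff_eq_0\<close>)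
  qed
qed

subsection \<open>Cylinders\<close>

text \<open>Triples associate to the right, so the base point \<open>(u, X)\<close> is not a
  projection of the type. These maps regroup the coordinates to match the triangular form of the
  nets.\<close>

definition base :: "real \<times> 'n \<times> real \<Rightarrow> real \<times> 'n" where
  "base z = (fst z, fst (snd z))"

definition height :: "real \<times> 'n \<times> real \<Rightarrow> real" where
  "height z = snd (snd z)"

definition at_height :: "real \<times> 'n \<Rightarrow> real \<Rightarrow> real \<times> 'n \<times> real" where
  "at_height q v = (fst q, snd q, v)"

lemma base_at_height [simp]: "base (at_height q v) = q"
  and height_at_height [simp]: "height (at_height q v) = v"
  and at_height_base_height [simp]: "at_height (base z) (height z) = z"
  by (simp_all add: base_def height_def at_height_def)

lemma base_diff: "base (z - z') = base z - base z'"
  and height_diff: "height (z - z') = height z - height z'"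
  by (simp_all add: base_def height_def)

lemma dist_base_le: "dist (base z) (base z') \<le> dist z z'"
  and dist_height_le: "dist (height z) (height z') \<le> dist z z'"
  for z z' :: "real \<times> 'n::euclidean_space \<times> real"
proof -
  show "dist (base z) (base z') \<le> dist z z'"
    by (simp add: base_def dist_prod_def)
  show "dist (height z) (height z') \<le> dist z z'"
    unfolding height_def by (rule order_trans[OF dist_snd_le dist_snd_le])
qed

lemma continuous_on_base [continuous_intros]:
  fixes f :: "'a::topological_space \<Rightarrow> real \<times> 'n::topological_space \<times> real"
  shows "continuous_on S f \<Longrightarrow> continuous_on S (\<lambda>x. base (f x))"
  unfolding base_def by (intro continuous_intros)

lemma continuous_on_height [continuous_intros]:
  fixes f :: "'a::topological_space \<Rightarrow> real \<times> 'n::topological_space \<times> real"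
  shows "continuous_on S f \<Longrightarrow> continuous_on S (\<lambda>x. height (f x))"
  unfolding height_def by (intro continuous_intros)

definition cylinder :: "real \<times> 'n::euclidean_space \<Rightarrow> real \<Rightarrow> real \<Rightarrow> real \<Rightarrow> (real \<times> 'n \<times> real) set" where
  "cylinder q r v m = {z. dist q (base z) < r \<and> \<bar>height z - v\<bar> < m}"

definition ccylinder :: "real \<times> 'n::euclidean_space \<Rightarrow> real \<Rightarrow> real \<Rightarrow> real \<Rightarrow> (real \<times> 'n \<times> real) set" where
  "ccylinder q r v m = {z. dist q (base z) \<le> r \<and> \<bar>height z - v\<bar> \<le> m}"

lemma open_cylinder: "open (cylinder q r v m)"
  unfolding cylinder_def by (intro open_Collect_conj open_Collect_less continuous_intros)

lemma compact_ccylinder: "compact (ccylinder q r v m)"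
proof -
  have "ccylinder q r v m = (\<lambda>y. at_height (fst y) (snd y)) ` (cball q r \<times> cball v m)"
    (is "?L = ?f ` ?S")
  proof
    show "?L \<subseteq> ?f ` ?S"
    proof
      fix z assume "z \<in> ?L"
      then show "z \<in> ?f ` ?S"
        by (intro image_eqI[of _ _ "(base z, height z)"]) (auto simp: ccylinder_def dist_real_def abs_minus_commute)
    qed
  qed (auto simp: ccylinder_def dist_real_def abs_minus_commute)
  moreover have "continuous_on ?S ?f"
    unfolding at_height_def by (intro continuous_intros)
  ultimately show ?thesis
    by (simp add: compact_continuous_image compact_Times)
qed

lemma bounded_cylinder: "bounded (cylinder q r v m)"
  by (rule bounded_subset[OF compact_imp_bounded[OF compact_ccylinder[of q r v m]]])
    (auto simp: cylinder_def ccylinder_def)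

text \<open>An ellipsoidal gauge: base and height need different scales because the height component of
  the net is only bounded, not convergent.\<close>

definition cylinder_gauge :: "real \<Rightarrow> real \<Rightarrow> real \<times> 'n::euclidean_space \<times> real \<Rightarrow> real" where
  "cylinder_gauge d m z = (norm (base z) / d)\<^sup>2 + (height z / m)\<^sup>2"

lemma cylinder_gauge_nonneg: "0 \<le> cylinder_gauge d m z"
  by (simp add: cylinder_gauge_def)

lemma cylinder_gauge_scale: "cylinder_gauge d m (c *\<^sub>R z) = c\<^sup>2 * cylinder_gauge d m z"
proof -
  have "base (c *\<^sub>R z) = c *\<^sub>R base z" "height (c *\<^sub>R z) = c * height z"
    by (simp_all add: base_def height_def)
  then show ?thesis by (simp add: cylinder_gauge_def power_mult_distrib power_divide algebra_simps)
qed

lemma continuous_on_cylinder_gauge: "continuous_on S (cylinder_gauge d m)"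
  unfolding cylinder_gauge_def divide_inverse by (intro continuous_intros)

text \<open>Together with its converse below, this compares ellipsoids and cylinders. Half the size
  in both variables gives level \<open>1/4 + 1/4 = 1/2\<close>, which leaves a margin below the
  level 1 up to which the truncation is the identity.\<close>

lemma cylinder_gauge_le:
  assumes "0 < d" "0 < m" "norm (base z) \<le> d * \<alpha>" "\<bar>height z\<bar> \<le> m * \<beta>"
  shows "cylinder_gauge d m z \<le> \<alpha>\<^sup>2 + \<beta>\<^sup>2"
proof -
  have "norm (base z) / d \<le> \<alpha>" "\<bar>height z / m\<bar> \<le> \<beta>"
    using assms by (simp_all add: field_simps)
  then have "\<bar>norm (base z) / d\<bar> \<le> \<bar>\<alpha>\<bar>" "\<bar>height z / m\<bar> \<le> \<bar>\<beta>\<bar>"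
    using assms(1) by (auto simp: abs_le_iff)
  then have "(norm (base z) / d)\<^sup>2 \<le> \<alpha>\<^sup>2" "(height z / m)\<^sup>2 \<le> \<beta>\<^sup>2"
    unfolding abs_le_square_iff .
  then show ?thesis by (simp add: cylinder_gauge_def)
qed

lemma cylinder_gauge_leD:
  assumes "0 < d" "0 < m" "0 \<le> \<alpha>" "cylinder_gauge d m z \<le> \<alpha>\<^sup>2"
  shows "norm (base z) \<le> d * \<alpha>" "\<bar>height z\<bar> \<le> m * \<alpha>"
proof -
  have "(norm (base z) / d)\<^sup>2 \<le> \<alpha>\<^sup>2" "(height z / m)\<^sup>2 \<le> \<alpha>\<^sup>2"
    using assms(4) unfolding cylinder_gauge_def by (smt (verit) zero_le_power2)+
  then have "norm (base z) / d \<le> \<alpha>" "\<bar>height z / m\<bar> \<le> \<alpha>"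
    using assms(3) power2_le_imp_le[of "norm (base z) / d" \<alpha>] abs_le_square_iff[of "height z / m" \<alpha>]
    by (simp_all only: abs_of_nonneg)
  then show "norm (base z) \<le> d * \<alpha>" "\<bar>height z\<bar> \<le> m * \<alpha>"
    using assms(1,2) by (simp_all add: field_simps)
qed

lemma moderate_upto_cylinder_gauge:
  assumes "0 < e"
  shows "moderate_upto e k UNIV (\<lambda>\<epsilon>. cylinder_gauge d m :: real \<times> 'n::euclidean_space \<times> real \<Rightarrow> real)"
proof -
  \<comment> \<open>The norm itself is not smooth at the origin; its square is a polynomial in the
    coordinates, to which the closure rules apply.\<close>
  have "cylinder_gauge d m z = (inverse d)\<^sup>2 * ((z \<bullet> (1, 0, 0)) * (z \<bullet> (1, 0, 0))
      + (\<Sum>b\<in>Basis. (z \<bullet> (0, b, 0)) * (z \<bullet> (0, b, 0))))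
      + (inverse m)\<^sup>2 * ((z \<bullet> (0, 0, 1)) * (z \<bullet> (0, 0, 1)))"
    for z :: "real \<times> 'n \<times> real"
  proof -
    have "(norm (base z))\<^sup>2 = fst z * fst z + fst (snd z) \<bullet> fst (snd z)"
      by (simp add: base_def norm_Pair power2_eq_square flip: power2_norm_eq_inner)
    also have "fst (snd z) \<bullet> fst (snd z) = (\<Sum>b\<in>Basis. (fst (snd z) \<bullet> b) * (fst (snd z) \<bullet> b))"
      by (rule euclidean_inner)
    finally have eq: "(norm (base z))\<^sup>2 = fst z * fst z
        + (\<Sum>b\<in>Basis. (fst (snd z) \<bullet> b) * (fst (snd z) \<bullet> b))" .
    show ?thesis
      unfolding cylinder_gauge_def height_def power_divide eq
      by (simp add: inner_prod_def divide_inverse power_inverse power2_eq_square[of "snd (snd z)"] mult.commute)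
  qed
  then have "(\<lambda>\<epsilon>::real. cylinder_gauge d m :: real \<times> 'n \<times> real \<Rightarrow> real) = (\<lambda>\<epsilon> z. (inverse d)\<^sup>2 * ((z \<bullet> (1, 0, 0)) * (z \<bullet> (1, 0, 0))
      + (\<Sum>b\<in>Basis. (z \<bullet> (0, b, 0)) * (z \<bullet> (0, b, 0))))
      + (inverse m)\<^sup>2 * ((z \<bullet> (0, 0, 1)) * (z \<bullet> (0, 0, 1))))"
    by (intro ext)
  moreover have "moderate_upto e k UNIV \<dots>"
    by (intro moderate_upto_add moderate_upto_mult moderate_upto_sum moderate_upto_const moderate_upto_inner open_UNIV assms)
  ultimately show ?thesis by (simp only:)
qed

subsection \<open>Inverting a net on a cylinder\<close>

lemma eventually_at_right_0_obtain:
  assumes "\<forall>\<^sub>F \<epsilon> in at_right (0::real). P \<epsilon>" "0 < e"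
  obtains e' where "0 < e'" "e' \<le> e" "\<And>\<epsilon>. 0 < \<epsilon> \<Longrightarrow> \<epsilon> \<le> e' \<Longrightarrow> P \<epsilon>"
proof -
  obtain b where b: "0 < b" "\<And>\<epsilon>. 0 < \<epsilon> \<Longrightarrow> \<epsilon> < b \<Longrightarrow> P \<epsilon>"
    using assms(1) by (auto simp: eventually_at_right_field)
  show thesis
    by (rule that[of "min e (b/2)"]) (use assms(2) b in auto)
qed

text \<open>Over a fixed base point \<open>t \<epsilon>\<close> is a translation of the height, so
  invertibility is decided by the base maps and only they have to converge. Two radii occur because
  the maps are controlled over \<open>2 * r\<close> but inverted over \<open>r\<close>: the inverses
  then take values in compact subsets of the larger open cylinder, as c-boundedness
  requires.\<close>

theorem cylindrical_net_invertible:
  fixes t :: "real \<Rightarrow> real \<times> 'n::euclidean_space \<times> real \<Rightarrow> real \<times> 'n \<times> real"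
    and \<phi> :: "real \<Rightarrow> real \<times> 'n \<Rightarrow> real \<times> 'n" and f :: "real \<Rightarrow> real \<times> 'n \<Rightarrow> real"
    and \<phi>0 :: "real \<times> 'n \<Rightarrow> real \<times> 'n" and q0 :: "real \<times> 'n" and v0 :: real
  assumes \<Lambda>: "open \<Lambda>" and t_mod: "moderate \<Lambda> t"
    and r: "0 < r" and e: "0 < e" "e \<le> 1"
    and \<Lambda>_dom: "\<And>z. base z \<in> cball q0 (2 * r) \<Longrightarrow> z \<in> \<Lambda>"
    and \<Lambda>_cod: "\<And>z. base z \<in> cball (\<phi>0 q0) r \<Longrightarrow> z \<in> \<Lambda>"
    and t_form: "\<And>\<epsilon> z. 0 < \<epsilon> \<Longrightarrow> \<epsilon> \<le> e \<Longrightarrow> base z \<in> cball q0 (2 * r) \<Longrightarrow>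
        t \<epsilon> z = at_height (\<phi> \<epsilon> (base z)) (height z + f \<epsilon> (base z))"
    and \<phi>_cont: "\<And>\<epsilon>. 0 < \<epsilon> \<Longrightarrow> \<epsilon> \<le> e \<Longrightarrow> continuous_on (cball q0 (2 * r)) (\<phi> \<epsilon>)"
    and \<phi>_inj: "\<And>\<epsilon>. 0 < \<epsilon> \<Longrightarrow> \<epsilon> \<le> e \<Longrightarrow> inj_on (\<phi> \<epsilon>) (cball q0 (2 * r))"
    and \<phi>0_cont: "continuous_on (cball q0 (2 * r)) \<phi>0"
    and \<phi>0_inj: "inj_on \<phi>0 (cball q0 (2 * r))"
    and conv: "\<And>d. 0 < d \<Longrightarrow>
        \<forall>\<^sub>F \<epsilon> in at_right 0. \<forall>q\<in>cball q0 (2 * r). dist (\<phi> \<epsilon> q) (\<phi>0 q) < d"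
    and f_bound: "\<And>\<epsilon> q. 0 < \<epsilon> \<Longrightarrow> \<epsilon> \<le> e \<Longrightarrow> q \<in> cball q0 (2 * r) \<Longrightarrow> \<bar>f \<epsilon> q\<bar> \<le> M"
    and C: "0 < C"
    and det: "\<And>\<epsilon> z. 0 < \<epsilon> \<Longrightarrow> \<epsilon> \<le> e \<Longrightarrow> base z \<in> cball q0 (2 * r) \<Longrightarrow>
        C * \<epsilon> ^ N \<le> \<bar>ldet (frechet_derivative (t \<epsilon>) (at z))\<bar>"
  shows "\<exists>A B Q D T.
       open A \<and> at_height q0 v0 \<in> A \<and> A \<subseteq> \<Lambda> \<and>
       open B \<and> bounded B \<and> B \<subseteq> \<Lambda> \<and>
       open Q \<and> bounded Q \<and> Q \<subseteq> \<Lambda> \<and> Q \<subseteq> B \<and>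
       open D \<and> bounded D \<and> D \<subseteq> \<Lambda> \<and> A \<subseteq> D \<and>
       gcbounded UNIV D T \<and>
       invertible_on \<Lambda> t A UNIV T B Q"
proof -
  define y0 where "y0 = \<phi>0 q0"
  have M: "0 \<le> M"
    using f_bound[OF e(1) order_refl, of q0] r by simp
  have sub: "cball q0 s \<subseteq> cball q0 (2 * r)" if "s \<le> r" for s
    using that r by (simp add: subset_cball)
  \<comment> \<open>Used at two scales: radius \<open>r\<close> gives the common domain of the
    inverses, radius \<open>s / 2\<close> the smaller region \<open>Q\<close> whose preimages remain
    well inside \<open>A\<close>.\<close>
  have inner_ball: "\<exists>d>0. \<forall>\<^sub>F \<epsilon> in at_right 0. ball y0 d \<subseteq> \<phi> \<epsilon> ` ball q0 s" if s: "0 < s" "s \<le> r" for s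
  proof -
    have 1: "\<forall>\<^sub>F \<epsilon> in at_right 0. continuous_on (cball q0 s) (\<phi> \<epsilon>) \<and> inj_on (\<phi> \<epsilon>) (cball q0 s)"
      using e(1) \<phi>_cont[THEN continuous_on_subset[OF _ sub[OF s(2)]]] \<phi>_inj[THEN inj_on_subset[OF _ sub[OF s(2)]]]
      by (auto simp: eventually_at_right_field intro!: exI[of _ e])
    have 2: "\<forall>\<^sub>F \<epsilon> in at_right 0. \<forall>q\<in>cball q0 s. dist (\<phi> \<epsilon> q) (\<phi>0 q) < d" if "0 < d" for d
      using conv[OF that] by eventually_elim (use sub[OF s(2)] in auto)
    have 3: "continuous_on (cball q0 s) \<phi>0" "inj_on \<phi>0 (cball q0 s)"
      using \<phi>0_cont \<phi>0_inj sub[OF s(2)] by (auto intro: continuous_on_subset inj_on_subset)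
    obtain d where "0 < d" "\<forall>\<^sub>F \<epsilon> in at_right 0. ball (\<phi>0 q0) d \<subseteq> \<phi> \<epsilon> ` ball q0 s"
      using ball_subset_images_of_approximations[OF s(1) 3 2 1] by blast
    then show ?thesis unfolding y0_def by blast
  qed
  obtain d1 where d1: "0 < d1" "\<forall>\<^sub>F \<epsilon> in at_right 0. ball y0 d1 \<subseteq> \<phi> \<epsilon> ` ball q0 r"
    using inner_ball[OF r] by auto
  \<comment> \<open>\<open>2 * d < d1\<close> keeps the range of the truncation, of base radius at
    most \<open>2 * d\<close>, inside the domain of the inverses; \<open>d \<le> r\<close> keeps
    \<open>B\<close> inside \<open>\<Lambda>\<close>.\<close>
  define d where "d = min (d1 / 3) r"
  have d: "0 < d" "2 * d < d1" "d \<le> r"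
    using d1 r by (auto simp: d_def)
  have "q0 \<in> cball q0 (2 * r)" using r by simp
  \<comment> \<open>\<open>d / 4\<close> from continuity of the limit and \<open>d / 4\<close> from
    uniform convergence add up to the \<open>d / 2\<close> in \<open>\<phi>_near\<close>, half the
    base size of the ellipsoid \<open>B\<close>.\<close>
  then obtain s0 where s0: "0 < s0"
    "\<And>q. q \<in> cball q0 (2 * r) \<Longrightarrow> dist q q0 < s0 \<Longrightarrow> dist (\<phi>0 q) y0 < d / 4"
    using \<phi>0_cont d(1) unfolding continuous_on_iff y0_def by (metis zero_less_divide_iff zero_less_numeral)
  define s where "s = min (s0 / 2) r"
  have s: "0 < s" "s \<le> r" "s < s0"
    using s0 r by (auto simp: s_def)
  obtain d2 where d2: "0 < d2" "\<forall>\<^sub>F \<epsilon> in at_right 0. ball y0 d2 \<subseteq> \<phi> \<epsilon> ` ball q0 (s / 2)"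
    using inner_ball[of "s / 2"] s by auto
  have "0 < d / 4" using d by simp
  from d1(2) d2(2) conv[OF this] have
    "\<forall>\<^sub>F \<epsilon> in at_right 0. ball y0 d1 \<subseteq> \<phi> \<epsilon> ` ball q0 r \<and> ball y0 d2 \<subseteq> \<phi> \<epsilon> ` ball q0 (s / 2) \<and>
      (\<forall>q\<in>cball q0 (2 * r). dist (\<phi> \<epsilon> q) (\<phi>0 q) < d / 4)"
    by eventually_elim simp
  then obtain e' where e': "0 < e'" "e' \<le> e" and
    big: "\<And>\<epsilon>. 0 < \<epsilon> \<Longrightarrow> \<epsilon> \<le> e' \<Longrightarrow> ball y0 d1 \<subseteq> \<phi> \<epsilon> ` ball q0 r" and
    small: "\<And>\<epsilon>. 0 < \<epsilon> \<Longrightarrow> \<epsilon> \<le> e' \<Longrightarrow> ball y0 d2 \<subseteq> \<phi> \<epsilon> ` ball q0 (s / 2)" and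
    near: "\<And>\<epsilon> q. 0 < \<epsilon> \<Longrightarrow> \<epsilon> \<le> e' \<Longrightarrow> q \<in> cball q0 (2 * r) \<Longrightarrow> dist (\<phi> \<epsilon> q) (\<phi>0 q) < d / 4"
    by (rule eventually_at_right_0_obtain[OF _ e(1)]) blast
  have e'1: "e' \<le> 1" using e e' by simp
  have \<phi>_near: "dist (\<phi> \<epsilon> q) y0 < d / 2" if "0 < \<epsilon>" "\<epsilon> \<le> e'" "q \<in> ball q0 s" for \<epsilon> q
  proof -
    have "q \<in> cball q0 (2 * r)" "dist q q0 < s0"
      using that s r by (auto simp: dist_commute)
    then show ?thesis
      using near[OF that(1,2), of q] s0(2)[of q] dist_triangle[of "\<phi> \<epsilon> q" y0 "\<phi>0 q"] by simp
  qed
  have form: "t \<epsilon> z = at_height (\<phi> \<epsilon> (base z)) (height z + f \<epsilon> (base z))"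
    if "0 < \<epsilon>" "\<epsilon> \<le> e'" "base z \<in> cball q0 (2 * r)" for \<epsilon> z
    using t_form that e' by simp
  have fM: "\<bar>f \<epsilon> q\<bar> \<le> M" if "0 < \<epsilon>" "\<epsilon> \<le> e'" "q \<in> cball q0 (2 * r)" for \<epsilon> q
    using f_bound that e' by simp

  define \<Omega> where "\<Omega> = {z :: real \<times> 'n \<times> real. base z \<in> ball q0 (2 * r)}"
  define \<Omega>' where "\<Omega>' = {z :: real \<times> 'n \<times> real. base z \<in> ball q0 r}"
  define Y where "Y = {z :: real \<times> 'n \<times> real. base z \<in> ball y0 d1}"
  have open\<Omega>: "open \<Omega>" and openY: "open Y"
    unfolding \<Omega>_def Y_def mem_ball by (intro open_Collect_less continuous_intros)+
  have \<Omega>'\<Omega>: "\<Omega>' \<subseteq> \<Omega>" using r by (auto simp: \<Omega>_def \<Omega>'_def)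
  have t_inj: "inj_on (t \<epsilon>) \<Omega>" if "0 < \<epsilon>" "\<epsilon> \<le> e'" for \<epsilon>
  proof (rule inj_onI)
    fix z z' assume z: "z \<in> \<Omega>" "z' \<in> \<Omega>" and eq: "t \<epsilon> z = t \<epsilon> z'"
    then have q: "base z \<in> cball q0 (2 * r)" "base z' \<in> cball q0 (2 * r)" by (auto simp: \<Omega>_def)
    have "\<phi> \<epsilon> (base z) = \<phi> \<epsilon> (base z')"
      using arg_cong[OF eq, of base] form[OF that] q by simp
    then have "base z = base z'"
      using inj_onD[OF \<phi>_inj, of \<epsilon> "base z" "base z'"] that e' q by simp
    moreover have "height z = height z'"
      using arg_cong[OF eq, of height] form[OF that] q \<open>base z = base z'\<close> by simp
    ultimately show "z = z'" by (metis at_height_base_height)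
  qed

  \<comment> \<open>Inverting over \<open>\<Omega>'\<close> instead of \<open>\<Omega>\<close>
    confines the base values to a ball whose closure still lies in the base of
    \<open>\<Omega>\<close>.\<close>
  define w where "w \<epsilon> = inv_into \<Omega>' (t \<epsilon>)" for \<epsilon>
  have w_t: "w \<epsilon> (t \<epsilon> z) = z" if "0 < \<epsilon>" "\<epsilon> \<le> e'" "z \<in> \<Omega>'" for \<epsilon> z
    unfolding w_def using inj_on_subset[OF t_inj[OF that(1,2)] \<Omega>'\<Omega>] that(3) by (rule inv_into_f_f)
  \<comment> \<open>A base preimage \<open>q\<close> lifts to a full preimage by solving the last
    component: the height must be \<open>height y - f \<epsilon> q\<close>.\<close>
  have preimage: "\<exists>z. base z \<in> ball q0 \<sigma> \<and> t \<epsilon> z = y"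
    if \<epsilon>: "0 < \<epsilon>" "\<epsilon> \<le> e'" and \<sigma>: "\<sigma> \<le> r" and y: "base y \<in> \<phi> \<epsilon> ` ball q0 \<sigma>" for \<epsilon> y \<sigma>
  proof -
    obtain q where q: "q \<in> ball q0 \<sigma>" "base y = \<phi> \<epsilon> q" using y by blast
    have "q \<in> cball q0 (2 * r)" using q(1) sub[OF \<sigma>] ball_subset_cball by blast
    then have "t \<epsilon> (at_height q (height y - f \<epsilon> q)) = at_height (\<phi> \<epsilon> q) (height y)"
      using form[OF \<epsilon>, of "at_height q (height y - f \<epsilon> q)"] by simp
    also have "\<dots> = y" by (simp flip: q(2))
    finally show ?thesis using q(1) by (intro exI[of _ "at_height q (height y - f \<epsilon> q)"]) simp
  qed
  have w_\<Omega>': "w \<epsilon> y \<in> \<Omega>'" and t_w: "t \<epsilon> (w \<epsilon> y) = y" if "0 < \<epsilon>" "\<epsilon> \<le> e'" "y \<in> Y" for \<epsilon> y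
  proof -
    have "base y \<in> \<phi> \<epsilon> ` ball q0 r" using that big[OF that(1,2)] by (auto simp: Y_def)
    from preimage[OF that(1,2) order_refl this] have "y \<in> t \<epsilon> ` \<Omega>'"
      unfolding \<Omega>'_def by blast
    then show "w \<epsilon> y \<in> \<Omega>'" "t \<epsilon> (w \<epsilon> y) = y"
      unfolding w_def by (rule inv_into_into, rule f_inv_into_f)
  qed
  \<comment> \<open>The reference level \<open>v\<close> is kept free: 0 is used for arbitrary
    compact sets, \<open>v0\<close> for the ranges around the given point.\<close>
  have w_height: "\<bar>height (w \<epsilon> y) - v\<bar> \<le> \<bar>height y - v\<bar> + M" if "0 < \<epsilon>" "\<epsilon> \<le> e'" "y \<in> Y" for \<epsilon> y v
  proof -
    have q: "base (w \<epsilon> y) \<in> cball q0 (2 * r)" using w_\<Omega>'[OF that] r by (auto simp: \<Omega>'_def)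
    have "height y = height (w \<epsilon> y) + f \<epsilon> (base (w \<epsilon> y))"
      using arg_cong[OF t_w[OF that], of height] form[OF that(1,2) q] by simp
    then show ?thesis using fM[OF that(1,2) q] by linarith
  qed

  have t_mod': "moderate_upto e' k \<Omega> (\<lambda>\<epsilon> x. t \<epsilon> x \<bullet> j)" if "j \<in> Basis" for k j
  proof -
    have "moderate_upto 1 k \<Lambda> (\<lambda>\<epsilon> x. t \<epsilon> x \<bullet> j)"
      using t_mod that unfolding moderate_iff_moderate_upto by blast
    then show ?thesis
      by (rule moderate_upto_antimono[OF moderate_upto_subset e'1]) (use \<Lambda>_dom in \<open>auto simp: \<Omega>_def\<close>)
  qed
  have w_mod: "moderate_upto e' k Y (\<lambda>\<epsilon> y. w \<epsilon> y \<bullet> j)" if "j \<in> Basis" for k j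
  proof (rule moderate_upto_local_inverse[OF e'(1) open\<Omega> openY t_mod' t_inj C _ _ _ that])
    show "C * \<epsilon> ^ N \<le> \<bar>ldet (frechet_derivative (t \<epsilon>) (at z))\<bar>" if "0 < \<epsilon>" "\<epsilon> \<le> e'" "z \<in> \<Omega>" for \<epsilon> z
      using that e' by (intro det) (auto simp: \<Omega>_def)
    show "w \<epsilon> y \<in> \<Omega> \<and> t \<epsilon> (w \<epsilon> y) = y" if "0 < \<epsilon>" "\<epsilon> \<le> e'" "y \<in> Y" for \<epsilon> y
      using w_\<Omega>'[OF that] t_w[OF that] \<Omega>'\<Omega> by blast
    fix K assume K: "compact K" "K \<subseteq> Y"
    have "bounded (height ` K)"
      using K by (intro compact_imp_bounded compact_continuous_image continuous_intros)
    then obtain H where H: "\<And>y. y \<in> K \<Longrightarrow> \<bar>height y\<bar> \<le> H" by (auto simp: bounded_iff)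
    have "w \<epsilon> ` K \<subseteq> ccylinder q0 r 0 (H + M)" if "0 < \<epsilon>" "\<epsilon> \<le> e'" for \<epsilon>
    proof (rule image_subsetI)
      fix y assume "y \<in> K"
      then have "y \<in> Y" using K by blast
      from w_\<Omega>'[OF that this] w_height[OF that this, of 0] H[OF \<open>y \<in> K\<close>]
      show "w \<epsilon> y \<in> ccylinder q0 r 0 (H + M)" by (simp add: ccylinder_def \<Omega>'_def)
    qed
    then have "\<forall>\<^sub>F \<epsilon> in at_right 0. w \<epsilon> ` K \<subseteq> ccylinder q0 r 0 (H + M)"
      unfolding eventually_at_right_field using e'(1) by (intro exI[of _ e']) simp
    moreover have "ccylinder q0 r 0 (H + M) \<subseteq> \<Omega>" using r by (auto simp: ccylinder_def \<Omega>_def)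
    ultimately show "\<exists>L. compact L \<and> L \<subseteq> \<Omega> \<and> (\<forall>\<^sub>F \<epsilon> in at_right 0. w \<epsilon> ` K \<subseteq> L)"
      by (intro exI[of _ "ccylinder q0 r 0 (H + M)"] conjI compact_ccylinder)
  qed

  \<comment> \<open>Chosen so that \<open>m / 2 = (M + 2) + M\<close>, the half-height of
    \<open>A\<close> plus the shift caused by \<open>t \<epsilon>\<close>.\<close>
  define m where "m = 4 * M + 4"
  have m: "0 < m" using M by (simp add: m_def)
  define z0 where "z0 = at_height y0 v0"
  let ?g = "\<lambda>z. cylinder_gauge d m (z - z0)"
  have g_le: "?g z \<le> \<alpha>\<^sup>2 + \<beta>\<^sup>2" if "dist (base z) y0 \<le> d * \<alpha>" "\<bar>height z - v0\<bar> \<le> m * \<beta>" for z \<alpha> \<beta>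
    using cylinder_gauge_le[OF d(1) m, of "z - z0"] that by (simp add: base_diff height_diff z0_def dist_norm)
  have g_leD: "dist (base z) y0 \<le> d * \<alpha>" "\<bar>height z - v0\<bar> \<le> m * \<alpha>" if "?g z \<le> \<alpha>\<^sup>2" "0 \<le> \<alpha>" for z \<alpha>
    using cylinder_gauge_leD[OF d(1) m that(2,1)] by (simp_all add: base_diff height_diff z0_def dist_norm)
  have g_cont: "continuous_on S ?g" for S
    by (intro continuous_on_compose2[OF continuous_on_cylinder_gauge[of UNIV]] continuous_intros) auto
  obtain \<rho> where \<rho>_cont: "continuous_on UNIV \<rho>"
    and \<rho>_mod: "\<And>k j. j \<in> Basis \<Longrightarrow> moderate_upto e' k UNIV (\<lambda>\<epsilon> z. \<rho> z \<bullet> j)"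
    and \<rho>_id: "\<And>z. ?g z \<le> 1 \<Longrightarrow> \<rho> z = z"
    and \<rho>_range: "\<And>z. ?g (\<rho> z) \<le> 4"
    using smooth_truncation[OF e'(1) moderate_upto_cylinder_gauge[OF e'(1)] cylinder_gauge_nonneg cylinder_gauge_scale] by blast
  have \<rho>_dist: "dist (base (\<rho> z)) y0 \<le> d * 2" "\<bar>height (\<rho> z) - v0\<bar> \<le> m * 2" for z
    using g_leD[of "\<rho> z" 2] \<rho>_range[of z] by simp_all
  have \<rho>_Y: "\<rho> z \<in> Y" for z
    using \<rho>_dist(1)[of z] d by (simp add: Y_def dist_commute)

  \<comment> \<open>The filler value for large \<epsilon> is the given point itself, so the range
    estimate below covers all positive \<epsilon>.\<close>
  define T where "T \<epsilon> z = (if \<epsilon> \<le> e' then w \<epsilon> (\<rho> z) else at_height q0 v0)" for \<epsilon> z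
  have T_mod: "moderate UNIV T"
    unfolding moderate_iff_moderate_upto
  proof (intro ballI allI)
    fix j :: "real \<times> 'n \<times> real" and k assume j: "j \<in> Basis"
    have "moderate_upto e' k UNIV (\<lambda>\<epsilon> z. w \<epsilon> (\<rho> z) \<bullet> j)"
      by (rule moderate_upto_compose_fixed[OF open_UNIV e'(1) _ \<rho>_cont w_mod[OF j] \<rho>_mod]) (use \<rho>_Y in auto)
    from moderate_upto_extend_const[OF e'(1) this, of 1 "at_height q0 v0 \<bullet> j"]
    show "moderate_upto 1 k UNIV (\<lambda>\<epsilon> z. T \<epsilon> z \<bullet> j)"
      by (simp add: T_def if_distrib[of "\<lambda>x. x \<bullet> j"])
  qed
  \<comment> \<open>The truncation moves heights at most \<open>2 * m\<close> away from
    \<open>v0\<close>, and the inverse adds at most \<open>M\<close>.\<close>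
  define R where "R = m * 2 + M"
  have T_range: "T \<epsilon> z \<in> ccylinder q0 r v0 R" if "0 < \<epsilon>" for \<epsilon> z
  proof (cases "\<epsilon> \<le> e'")
    case True
    have "base (w \<epsilon> (\<rho> z)) \<in> ball q0 r"
      using w_\<Omega>'[OF that True \<rho>_Y] by (simp add: \<Omega>'_def)
    moreover have "\<bar>height (w \<epsilon> (\<rho> z)) - v0\<bar> \<le> R"
      using w_height[OF that True \<rho>_Y, of z v0] \<rho>_dist(2)[of z] by (simp add: R_def)
    ultimately show ?thesis using True by (simp add: T_def ccylinder_def)
  next
    case False
    then show ?thesis using r M m by (simp add: T_def ccylinder_def R_def)
  qed

  \<comment> \<open>The heights interlock: \<open>Q\<close> has half-height 1, its preimages have at
    most \<open>M + 1\<close>, which is strictly inside the \<open>M + 2\<close> of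
    \<open>A\<close>; images of \<open>A\<close> have at most \<open>2 * M + 2\<close>, half the
    height of \<open>B\<close>. In the base, \<open>d2\<close> controls preimages of
    \<open>Q\<close>, and \<open>d / 2\<close> puts \<open>Q\<close> into the ellipsoid.\<close>
  define A where "A = cylinder q0 s v0 (M + 2)"
  define B where "B = {z. ?g z < 1}"
  define Q where "Q = cylinder y0 (min d2 (d / 2)) v0 1"
  define D where "D = cylinder q0 (2 * r) v0 (R + 1)"
  have A\<Omega>': "A \<subseteq> \<Omega>'" using s by (auto simp: A_def cylinder_def \<Omega>'_def)
  have D\<Lambda>: "D \<subseteq> \<Lambda>" using \<Lambda>_dom by (auto simp: D_def cylinder_def)
  have AD: "A \<subseteq> D" using s r m M by (auto simp: A_def D_def R_def m_def cylinder_def)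
  have B_sub: "B \<subseteq> ccylinder y0 d v0 m"
  proof
    fix z assume "z \<in> B"
    then show "z \<in> ccylinder y0 d v0 m"
      using g_leD[of z 1] by (simp add: B_def ccylinder_def dist_commute)
  qed
  have openB: "open B"
    unfolding B_def by (intro open_Collect_less g_cont continuous_intros)
  have Q_half: "?g z \<le> 1 / 2" if "z \<in> Q" for z
    \<comment> \<open>The height fraction is \<open>1/4\<close> because
      \<open>1 \<le> m / 4 = M + 1\<close>, and \<open>1/4 + 1/16\<close> is below
      \<open>1/2\<close>.\<close>
    using g_le[of z "1/2" "1/4"] that m M by (simp add: Q_def cylinder_def dist_commute m_def power2_eq_square)
  have B\<Lambda>: "B \<subseteq> \<Lambda>"
    using B_sub \<Lambda>_cod d(3) by (fastforce simp: ccylinder_def y0_def)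
  have QB: "Q \<subseteq> B" using Q_half by (force simp: B_def)

  have T_cb: "cbounded_net UNIV D T"
  proof (rule cbounded_netI[OF T_mod e'(1)])
    have "ccylinder q0 r v0 R \<subseteq> D" using r by (auto simp: ccylinder_def D_def cylinder_def)
    then show "\<exists>L. compact L \<and> L \<subseteq> D \<and> (\<forall>\<epsilon>. 0 < \<epsilon> \<and> \<epsilon> \<le> e' \<longrightarrow> T \<epsilon> ` K \<subseteq> L)" for K
      using T_range by (intro exI[of _ "ccylinder q0 r v0 R"] conjI compact_ccylinder) blast+
  qed

  have t_A: "?g (t \<epsilon> z) \<le> 1 / 2" if "0 < \<epsilon>" "\<epsilon> \<le> e'" "z \<in> A" for \<epsilon> z
  proof -
    have q: "base z \<in> ball q0 s" and h: "\<bar>height z - v0\<bar> < M + 2" using that by (auto simp: A_def cylinder_def)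
    then have q': "base z \<in> cball q0 (2 * r)" using s r by auto
    have 1: "dist (base (t \<epsilon> z)) y0 \<le> d * (1/2)"
      using \<phi>_near[OF that(1,2) q] form[OF that(1,2) q'] by simp
    have "\<bar>height z - v0 + f \<epsilon> (base z)\<bar> \<le> 2 * M + 2"
      using abs_triangle_ineq[of "height z - v0" "f \<epsilon> (base z)"] h fM[OF that(1,2) q'] by simp
    then have 2: "\<bar>height (t \<epsilon> z) - v0\<bar> \<le> m * (1/2)"
      using form[OF that(1,2) q'] by (simp add: m_def algebra_simps)
    from g_le[OF 1 2] show ?thesis by (simp add: power2_eq_square)
  qed
  have left: "left_invertible \<Lambda> t A UNIV T B"
    unfolding left_invertible_def
  proof (intro conjI exI[of _ t])
    show "cbounded_net A B t"
    proof (rule cbounded_netI[OF moderate_subset[OF t_mod] e'(1)])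
      \<comment> \<open>One compact sublevel set serves every \<open>K\<close>: by
        \<open>t_A\<close> the image of all of \<open>A\<close> lies in it.\<close>
      let ?L = "{z. ?g z \<le> 1/2}"
      have "closed ?L" by (intro closed_Collect_le g_cont continuous_intros)
      moreover have "?L \<subseteq> B" by (auto simp: B_def)
      ultimately have "compact ?L"
        using compact_ccylinder[of y0 d v0 m] B_sub by (metis compact_Int_closed inf.absorb_iff2 subset_trans)
      then show "\<exists>L. compact L \<and> L \<subseteq> B \<and> (\<forall>\<epsilon>. 0 < \<epsilon> \<and> \<epsilon> \<le> e' \<longrightarrow> t \<epsilon> ` K \<subseteq> L)" if "K \<subseteq> A" for K
        using \<open>?L \<subseteq> B\<close> t_A that by (intro exI[of _ ?L]) blast
    qed (use AD D\<Lambda> in auto)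
    \<comment> \<open>Points \<open>t \<epsilon> z\<close> with \<open>z\<close> in \<open>A\<close>
      have gauge at most \<open>1/2\<close>, so the truncation fixes them and \<open>T\<close> acts
      as the genuine inverse.\<close>
    have zero: "T \<epsilon> (t \<epsilon> z) - z = 0" if "0 < \<epsilon>" "\<epsilon> \<le> e'" "z \<in> A" for \<epsilon> z
    proof -
      have "z \<in> \<Omega>'" using that(3) A\<Omega>' by blast
      from w_t[OF that(1,2) this] show ?thesis
        using that(2) \<rho>_id[of "t \<epsilon> z"] t_A[OF that] by (simp add: T_def)
    qed
    show "negligible_net A (\<lambda>\<epsilon> z. T \<epsilon> (t \<epsilon> z) - z)"
      by (rule negligible_net_eventually_zero[OF _ e'(1) zero]) (simp_all add: A_def open_cylinder)
  qed (use \<Lambda> t_mod AD D\<Lambda> openB T_mod gequiv_refl in \<open>auto simp: A_def open_cylinder\<close>)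

  have T_Q: "T \<epsilon> y \<in> ccylinder q0 (s / 2) v0 (M + 1)" "t \<epsilon> (T \<epsilon> y) = y"
    if \<epsilon>: "0 < \<epsilon>" "\<epsilon> \<le> e'" and y: "y \<in> Q" for \<epsilon> y
  proof -
    have Tw: "T \<epsilon> y = w \<epsilon> y" using \<epsilon> \<rho>_id[of y] Q_half[OF y] by (simp add: T_def)
    have b: "base y \<in> ball y0 d2" "base y \<in> ball y0 d1" and h: "\<bar>height y - v0\<bar> < 1"
      using y d by (auto simp: Q_def cylinder_def)
    have yY: "y \<in> Y" using b by (simp add: Y_def)
    have "base y \<in> \<phi> \<epsilon> ` ball q0 (s / 2)" using small[OF \<epsilon>] b by blast
    then obtain z where z: "base z \<in> ball q0 (s / 2)" "t \<epsilon> z = y"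
      using preimage[OF \<epsilon>, of "s / 2" y] s by auto
    \<comment> \<open>\<open>w \<epsilon> y\<close> was selected in all of \<open>\<Omega>'\<close>;
      injectivity identifies it with the preimage over the smaller ball and so improves its base
      radius to \<open>s / 2\<close>.\<close>
    have "w \<epsilon> y = z"
      using w_t[OF \<epsilon>, of z] z s by (simp add: \<Omega>'_def)
    with z w_height[OF \<epsilon> yY, of v0] h
    show "T \<epsilon> y \<in> ccylinder q0 (s / 2) v0 (M + 1)" "t \<epsilon> (T \<epsilon> y) = y"
      unfolding Tw by (simp_all add: ccylinder_def)
  qed
  have right: "right_invertible \<Lambda> t A UNIV T Q"
    unfolding right_invertible_def
  proof (intro conjI exI[of _ T])
    show "cbounded_net Q A T"
    proof (rule cbounded_netI[OF moderate_subset[OF T_mod] e'(1)])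
      have "ccylinder q0 (s / 2) v0 (M + 1) \<subseteq> A" using s by (auto simp: ccylinder_def A_def cylinder_def)
      then show "\<exists>L. compact L \<and> L \<subseteq> A \<and> (\<forall>\<epsilon>. 0 < \<epsilon> \<and> \<epsilon> \<le> e' \<longrightarrow> T \<epsilon> ` K \<subseteq> L)" if "K \<subseteq> Q" for K
        using compact_ccylinder T_Q(1) that by (intro exI[of _ "ccylinder q0 (s / 2) v0 (M + 1)"]) blast
    qed auto
    show "negligible_net Q (\<lambda>\<epsilon> y. t \<epsilon> (T \<epsilon> y) - y)"
    proof (rule negligible_net_eventually_zero[OF _ e'(1)])
      show "open Q" by (simp add: Q_def open_cylinder)
      show "t \<epsilon> (T \<epsilon> y) - y = 0" if "0 < \<epsilon>" "\<epsilon> \<le> e'" "y \<in> Q" for \<epsilon> y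
        using T_Q(2)[OF that] by simp
    qed
  qed (use \<Lambda> t_mod AD D\<Lambda> T_mod gequiv_refl in \<open>auto simp: A_def Q_def open_cylinder\<close>)

  have gcb: "gcbounded UNIV D T"
    using T_cb T_mod gequiv_refl[of UNIV T] unfolding gcbounded_def by blast
  have p: "at_height q0 v0 \<in> A" using s M by (simp add: A_def cylinder_def)
  have bB: "bounded B"
    using bounded_subset[OF compact_imp_bounded[OF compact_ccylinder] B_sub] .
  have topo: "open A" "open Q" "open D" "bounded Q" "bounded D"
    unfolding A_def Q_def D_def by (rule open_cylinder bounded_cylinder)+
  have inv: "invertible_on \<Lambda> t A UNIV T B Q"
    unfolding invertible_on_def by (rule conjI[OF left right])
  have "A \<subseteq> \<Lambda>" "Q \<subseteq> \<Lambda>" using AD D\<Lambda> QB B\<Lambda> by blast+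
  then show ?thesis
    by (intro exI[of _ A] exI[of _ B] exI[of _ Q] exI[of _ D] exI[of _ T] conjI
        topo p openB bB B\<Lambda> QB D\<Lambda> AD gcb inv)
qed

section \<open>The domain \<Lambda> and the passage from the hypotheses to cylinders\<close>

lemma open_ival: "open (ival a b)"
  unfolding ival_def by (intro open_Collect_conj open_Collect_less continuous_intros)

lemma mem_Lam_iff: "z \<in> Lam a b \<longleftrightarrow> fst z \<in> ival a b"
  by (cases z) (auto simp: Lam_def)

lemma open_Lam: "open (Lam a b :: (real \<times> 'n::euclidean_space \<times> real) set)"
proof -
  have "(Lam a b :: (real \<times> 'n \<times> real) set) = ival a b \<times> UNIV" by (auto simp: mem_Lam_iff)
  then show ?thesis by (simp add: open_Times open_ival)
qed

theorem theorem8p4: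
  fixes a b :: ereal
    and t s\<epsilon> :: "real \<Rightarrow> real \<times> 'n::euclidean_space \<times> real \<Rightarrow> real \<times> 'n \<times> real"
    and s :: "real \<times> 'n \<times> real \<Rightarrow> real \<times> 'n \<times> real"
    and x\<epsilon> :: "real \<Rightarrow> real \<times> 'n \<Rightarrow> 'n"
    and g\<epsilon> h\<epsilon> :: "real \<Rightarrow> real \<times> 'n \<Rightarrow> real"
    and x :: "real \<times> 'n \<Rightarrow> 'n"
    and g :: "real \<times> 'n \<Rightarrow> real"
  assumes a_pos: "a > 0" and b_pos: "b > 0"
    \<comment> \<open>(1)\<close>
    and t_form: "\<And>\<epsilon> u X v. 0 < \<epsilon> \<Longrightarrow> \<epsilon> \<le> 1 \<Longrightarrow> u \<in> ival a b \<Longrightarrow>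
        t \<epsilon> (u, X, v) = (u, x\<epsilon> \<epsilon> (u, X), v + g\<epsilon> \<epsilon> (u, X) + h\<epsilon> \<epsilon> (u, X))"
    and x\<epsilon>_smooth: "\<And>\<epsilon>. 0 < \<epsilon> \<Longrightarrow> \<epsilon> \<le> 1 \<Longrightarrow> vsmooth_on (ival a b \<times> UNIV) (x\<epsilon> \<epsilon>)"
    and g\<epsilon>_smooth: "\<And>\<epsilon>. 0 < \<epsilon> \<Longrightarrow> \<epsilon> \<le> 1 \<Longrightarrow> smooth_on (ival a b \<times> UNIV) (g\<epsilon> \<epsilon>)"
    and h\<epsilon>_smooth: "\<And>\<epsilon>. 0 < \<epsilon> \<Longrightarrow> \<epsilon> \<le> 1 \<Longrightarrow> smooth_on (ival a b \<times> UNIV) (h\<epsilon> \<epsilon>)"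
    and h\<epsilon>_bdd: "\<And>K. compact K \<Longrightarrow> K \<subseteq> ival a b \<times> UNIV \<Longrightarrow>
        \<exists>C. \<forall>\<epsilon>. 0 < \<epsilon> \<and> \<epsilon> \<le> 1 \<longrightarrow> (\<forall>q\<in>K. \<bar>h\<epsilon> \<epsilon> q\<bar> \<le> C)"
    and t_Eplus: "propEplus a b t"
    \<comment> \<open>(2)\<close>
    and s\<epsilon>_form: "\<And>\<epsilon> u X v. 0 < \<epsilon> \<Longrightarrow> \<epsilon> \<le> 1 \<Longrightarrow> u \<in> ival a b \<Longrightarrow>
        s\<epsilon> \<epsilon> (u, X, v) = (u, x\<epsilon> \<epsilon> (u, X), v + g\<epsilon> \<epsilon> (u, X))"
    and s\<epsilon>_E: "propE a b s\<epsilon>"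
    \<comment> \<open>(3)\<close>
    and s_form: "\<And>u X v. u \<in> ival a b \<Longrightarrow> s (u, X, v) = (u, x (u, X), v + g (u, X))"
    and x_cont: "continuous_on (ival a b \<times> UNIV) x"
    and g_cont: "continuous_on (ival a b \<times> UNIV) g"
    and W: "\<exists>W. open W \<and> W \<subseteq> ival a b \<times> UNIV \<and>
        {(u, X). - a < ereal u \<and> u \<le> 0} \<subseteq> W \<and> inj_on (\<lambda>(u, X). (u, x (u, X))) W"
    \<comment> \<open>(4)\<close>
    and s\<epsilon>_conv: "\<And>K e. compact K \<Longrightarrow> K \<subseteq> Lam a b \<Longrightarrow> e > 0 \<Longrightarrow>
        \<exists>\<epsilon>0>0. \<forall>\<epsilon>. 0 < \<epsilon> \<and> \<epsilon> \<le> \<epsilon>0 \<and> \<epsilon> \<le> 1 \<longrightarrow> (\<forall>q\<in>K. dist (s\<epsilon> \<epsilon> q) (s q) < e)"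
    \<comment> \<open>(5)\<close>
    and T_cb: "gcbounded (Lam a b) (Lam a b) t"
    and S_cb: "gcbounded (Lam a b) (Lam a b) s\<epsilon>"
  shows "\<forall>p\<in>Lam a b. fst p = 0 \<longrightarrow>
    (\<exists>A B Q D (Tdia :: real \<Rightarrow> real \<times> 'n \<times> real \<Rightarrow> real \<times> 'n \<times> real).
       open A \<and> p \<in> A \<and> A \<subseteq> Lam a b \<and>
       open B \<and> bounded B \<and> B \<subseteq> Lam a b \<and>
       open Q \<and> bounded Q \<and> Q \<subseteq> Lam a b \<and> Q \<subseteq> B \<and>
       open D \<and> bounded D \<and> D \<subseteq> Lam a b \<and> A \<subseteq> D \<and>
       gcbounded UNIV D Tdia \<and>
       invertible_on (Lam a b) t A UNIV Tdia B Q)"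
proof (intro ballI impI)
  fix p :: "real \<times> 'n \<times> real" assume p: "p \<in> Lam a b" "fst p = 0"
  define q0 where "q0 = base p"
  define v0 where "v0 = height p"
  define \<phi> where "\<phi> \<epsilon> q = (fst q, x\<epsilon> \<epsilon> q)" for \<epsilon> q
  define \<phi>0 where "\<phi>0 q = (fst q, x q)" for q
  define f where "f \<epsilon> q = g\<epsilon> \<epsilon> q + h\<epsilon> \<epsilon> q" for \<epsilon> q
  have q0: "fst q0 = 0" using p(2) by (simp add: q0_def base_def)
  have t_mod: "moderate (Lam a b) t" using T_cb by (simp add: gcbounded_def)
  obtain W0 where W0: "open W0" "W0 \<subseteq> ival a b \<times> UNIV"
    "{(u, X). - a < ereal u \<and> u \<le> 0} \<subseteq> W0" "inj_on (\<lambda>(u, X). (u, x (u, X))) W0"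
    using W by blast
  have "- a < ereal 0" using a_pos by (cases a) auto
  then have "(fst q0, snd q0) \<in> W0" using q0 by (intro subsetD[OF W0(3)]) simp
  then have q0W: "q0 \<in> W0" by simp
  define Z where "Z \<alpha> = {(r, X, v :: real). - a < ereal r \<and> r \<le> \<alpha> \<and> X \<in> cball (snd q0) 1}" for \<alpha>
  from t_Eplus[unfolded propEplus_def, THEN spec, THEN mp, OF compact_cball, of "snd q0" 1, folded Z_def]
  obtain \<alpha> \<epsilon>1 C and N :: nat where "0 < \<alpha> \<and> ereal \<alpha> < b \<and> 0 < \<epsilon>1 \<and> \<epsilon>1 \<le> 1 \<and> 0 < C \<and>
      (\<forall>\<epsilon>. 0 < \<epsilon> \<and> \<epsilon> \<le> \<epsilon>1 \<longrightarrow> inj_on (t \<epsilon>) (Z \<alpha>) \<and>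
        (\<forall>p\<in>Z \<alpha>. C * \<epsilon> ^ N \<le> \<bar>ldet (frechet_derivative (t \<epsilon>) (at p))\<bar>))"
    by (elim exE) (rule that)
  then have \<alpha>: "0 < \<alpha>" and \<epsilon>1: "0 < \<epsilon>1" "\<epsilon>1 \<le> 1" and C: "0 < C"
    and t_E: "\<And>\<epsilon>. 0 < \<epsilon> \<Longrightarrow> \<epsilon> \<le> \<epsilon>1 \<Longrightarrow> inj_on (t \<epsilon>) (Z \<alpha>) \<and>
        (\<forall>p\<in>Z \<alpha>. C * \<epsilon> ^ N \<le> \<bar>ldet (frechet_derivative (t \<epsilon>) (at p))\<bar>)"
    by simp_all
  \<comment> \<open>The three conditions secure injectivity of the limit, the range of
    \<open>u\<close> in (E+), and membership of \<open>X\<close> in the compact unit ball for which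
    (E+) was invoked.\<close>
  have "open (W0 \<inter> {q. fst q < \<alpha>} \<inter> ball q0 1)"
    by (intro open_Int W0 open_ball open_Collect_less continuous_intros)
  moreover have "q0 \<in> W0 \<inter> {q. fst q < \<alpha>} \<inter> ball q0 1"
    using q0W q0 \<alpha> by simp
  ultimately obtain r' where r': "0 < r'" "cball q0 r' \<subseteq> W0 \<inter> {q. fst q < \<alpha>} \<inter> ball q0 1"
    using open_contains_cball by meson
  define r where "r = r' / 2"
  have r: "0 < r" and K: "cball q0 (2 * r) \<subseteq> W0 \<inter> {q. fst q < \<alpha>} \<inter> ball q0 1"
    using r' by (simp_all add: r_def)
  let ?K = "cball q0 (2 * r)"
  have K_ival: "?K \<subseteq> ival a b \<times> UNIV" using K W0(2) by blast
  have fst_ival: "fst q \<in> ival a b" if "q \<in> ?K" for q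
    using subsetD[OF K_ival that] by (simp add: mem_Times_iff)
  have Z: "z \<in> Z \<alpha>" if "base z \<in> ?K" for z
  proof -
    have "fst (base z) < \<alpha>" "dist q0 (base z) < 1" using subsetD[OF K that] by auto
    moreover have "dist (snd q0) (snd (base z)) \<le> dist q0 (base z)" by (rule dist_snd_le)
    ultimately show ?thesis
      using fst_ival[OF that] by (cases z) (simp add: Z_def base_def ival_def)
  qed

  have t_form': "t \<epsilon> z = at_height (\<phi> \<epsilon> (base z)) (height z + f \<epsilon> (base z))"
    if "0 < \<epsilon>" "\<epsilon> \<le> 1" "fst z \<in> ival a b" for \<epsilon> z
    using t_form[OF that, of "fst (snd z)" "snd (snd z)"]
    by (simp add: base_def height_def at_height_def \<phi>_def f_def)
  have s\<epsilon>_form': "s\<epsilon> \<epsilon> (at_height q 0) = at_height (\<phi> \<epsilon> q) (g\<epsilon> \<epsilon> q)"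
    if "0 < \<epsilon>" "\<epsilon> \<le> 1" "fst q \<in> ival a b" for \<epsilon> q
    using s\<epsilon>_form[OF that, of "snd q" 0] by (simp add: at_height_def \<phi>_def)
  have s_form': "s (at_height q 0) = at_height (\<phi>0 q) (g q)" if "fst q \<in> ival a b" for q
    using s_form[OF that, of "snd q" 0] by (simp add: at_height_def \<phi>0_def)

  \<comment> \<open>Evaluating the convergence of \<open>s\<epsilon>\<close> on the slice of height
    0 separates it into convergence of the base maps and of \<open>g\<epsilon>\<close>.\<close>
  have conv: "\<exists>\<epsilon>0>0. \<forall>\<epsilon>. 0 < \<epsilon> \<and> \<epsilon> \<le> \<epsilon>0 \<and> \<epsilon> \<le> 1 \<longrightarrow>
      (\<forall>q\<in>?K. dist (\<phi> \<epsilon> q) (\<phi>0 q) < d \<and> dist (g\<epsilon> \<epsilon> q) (g q) < d)" if d: "0 < d" for d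
  proof -
    have 1: "compact ((\<lambda>q. at_height q 0) ` ?K)"
      unfolding at_height_def by (intro compact_continuous_image continuous_intros compact_cball)
    have 2: "(\<lambda>q. at_height q 0) ` ?K \<subseteq> Lam a b"
      using fst_ival by (auto simp: mem_Lam_iff at_height_def simp del: mem_cball)
    from s\<epsilon>_conv[OF 1 2 d] obtain \<epsilon>0 where \<epsilon>0: "0 < \<epsilon>0" "\<forall>\<epsilon>. 0 < \<epsilon> \<and> \<epsilon> \<le> \<epsilon>0 \<and> \<epsilon> \<le> 1 \<longrightarrow>
        (\<forall>z\<in>(\<lambda>q. at_height q 0) ` ?K. dist (s\<epsilon> \<epsilon> z) (s z) < d)"
      by (elim exE conjE) (rule that)
    have conv_at_height: "dist (s\<epsilon> \<epsilon> (at_height q 0)) (s (at_height q 0)) < d"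
      if "0 < \<epsilon>" "\<epsilon> \<le> \<epsilon>0" "\<epsilon> \<le> 1" "q \<in> ?K" for \<epsilon> q
      using \<epsilon>0(2)[THEN spec, THEN mp, of \<epsilon>] that by simp
    have "dist (\<phi> \<epsilon> q) (\<phi>0 q) < d \<and> dist (g\<epsilon> \<epsilon> q) (g q) < d"
      if "0 < \<epsilon>" "\<epsilon> \<le> \<epsilon>0" "\<epsilon> \<le> 1" "q \<in> ?K" for \<epsilon> q
      using conv_at_height[OF that] s\<epsilon>_form'[OF that(1,3) fst_ival[OF that(4)]] s_form'[OF fst_ival[OF that(4)]]
        dist_base_le[of "s\<epsilon> \<epsilon> (at_height q 0)" "s (at_height q 0)"]
        dist_height_le[of "s\<epsilon> \<epsilon> (at_height q 0)" "s (at_height q 0)"]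
      by simp
    with \<epsilon>0(1) show ?thesis by blast
  qed

  \<comment> \<open>For small \<epsilon> this bounds \<open>g\<epsilon>\<close> by the bound of its
    continuous limit plus 1; \<open>h\<epsilon>\<close> is bounded by hypothesis. Their sum is the
    height shift \<open>f\<close>.\<close>
  obtain \<epsilon>2 where \<epsilon>2: "0 < \<epsilon>2"
    "\<And>\<epsilon> q. 0 < \<epsilon> \<Longrightarrow> \<epsilon> \<le> \<epsilon>2 \<Longrightarrow> \<epsilon> \<le> 1 \<Longrightarrow> q \<in> ?K \<Longrightarrow> dist (g\<epsilon> \<epsilon> q) (g q) < 1"
    using conv[OF zero_less_one] by blast
  have "bounded (g ` ?K)"
    using g_cont K_ival
    by (intro compact_imp_bounded compact_continuous_image compact_cball) (rule continuous_on_subset)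
  then obtain G where G: "\<And>q. q \<in> ?K \<Longrightarrow> \<bar>g q\<bar> \<le> G"
    unfolding bounded_iff by (metis imageI real_norm_def)
  obtain H where H: "\<And>\<epsilon> q. 0 < \<epsilon> \<Longrightarrow> \<epsilon> \<le> 1 \<Longrightarrow> q \<in> ?K \<Longrightarrow> \<bar>h\<epsilon> \<epsilon> q\<bar> \<le> H"
    using h\<epsilon>_bdd[OF compact_cball K_ival] by blast
  define e where "e = min \<epsilon>1 \<epsilon>2"
  have e: "0 < e" "e \<le> \<epsilon>1" "e \<le> \<epsilon>2" "e \<le> 1"
    using \<epsilon>1 \<epsilon>2(1) by (auto simp: e_def)
  have f_bound: "\<bar>f \<epsilon> q\<bar> \<le> G + H + 1" if "0 < \<epsilon>" "\<epsilon> \<le> e" "q \<in> ?K" for \<epsilon> q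
    using \<epsilon>2(2)[of \<epsilon> q] G[of q] H[of \<epsilon> q] that e unfolding f_def dist_real_def by linarith

  have "\<exists>A B Q D T.
       open A \<and> at_height q0 v0 \<in> A \<and> A \<subseteq> Lam a b \<and>
       open B \<and> bounded B \<and> B \<subseteq> Lam a b \<and>
       open Q \<and> bounded Q \<and> Q \<subseteq> Lam a b \<and> Q \<subseteq> B \<and>
       open D \<and> bounded D \<and> D \<subseteq> Lam a b \<and> A \<subseteq> D \<and>
       gcbounded UNIV D T \<and> invertible_on (Lam a b) t A UNIV T B Q"
  proof (rule cylindrical_net_invertible[OF open_Lam t_mod r e(1,4) _ _ _ _ _ _ _ _ f_bound C])
    show base_Lam: "z \<in> Lam a b" if "base z \<in> ?K" for z
      using fst_ival[OF that] by (simp add: mem_Lam_iff base_def)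
    show "z \<in> Lam a b" if "base z \<in> cball (\<phi>0 q0) r" for z
    proof -
      \<comment> \<open>\<open>\<phi>0\<close> preserves the first coordinate, which is 0 at
        \<open>q0\<close>, and \<Lambda> restricts that coordinate alone. Replacing the rest of the
        base point by \<open>snd q0\<close> therefore gives a point of \<open>?K\<close> that
        decides membership.\<close>
      have "dist (fst (\<phi>0 q0)) (fst (base z)) \<le> r"
        using that by (intro order_trans[OF dist_fst_le]) simp
      then have "(fst z, snd q0) \<in> ?K"
        using q0 r by (cases q0) (simp add: \<phi>0_def base_def dist_prod_def)
      from fst_ival[OF this] show ?thesis by (simp add: mem_Lam_iff)
    qed
    show "t \<epsilon> z = at_height (\<phi> \<epsilon> (base z)) (height z + f \<epsilon> (base z))"
      if "0 < \<epsilon>" "\<epsilon> \<le> e" "base z \<in> ?K" for \<epsilon> z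
      using t_form'[OF that(1)] that e base_Lam[OF that(3)] by (simp add: mem_Lam_iff)
    show "continuous_on ?K (\<phi> \<epsilon>)" if "0 < \<epsilon>" "\<epsilon> \<le> e" for \<epsilon>
    proof -
      have \<epsilon>: "\<epsilon> \<le> 1" using that e by simp
      have at_height: "continuous_on ?K (\<lambda>q. at_height q (0::real))"
        unfolding at_height_def by (intro continuous_intros)
      have "(\<lambda>q. at_height q 0) ` ?K \<subseteq> Lam a b"
        using base_Lam[of "at_height _ 0"] by (intro image_subsetI) simp
      from continuous_on_base[OF continuous_on_compose2[OF moderate_imp_continuous_on[OF t_mod that(1) \<epsilon>] at_height this]]
      show ?thesis
      proof (rule continuous_on_eq)
        fix q assume "q \<in> ?K"
        then have "at_height q (0::real) \<in> Lam a b" using base_Lam[of "at_height q 0"] by simp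
        then show "base (t \<epsilon> (at_height q 0)) = \<phi> \<epsilon> q"
          using t_form'[OF that(1) \<epsilon>, of "at_height q 0"] by (simp add: mem_Lam_iff)
      qed
    qed
    show "inj_on (\<phi> \<epsilon>) ?K" if "0 < \<epsilon>" "\<epsilon> \<le> e" for \<epsilon>
    proof (rule inj_onI)
      fix q q' assume q: "q \<in> ?K" "q' \<in> ?K" and eq: "\<phi> \<epsilon> q = \<phi> \<epsilon> q'"
      have \<epsilon>: "\<epsilon> \<le> 1" "\<epsilon> \<le> \<epsilon>1" using that e by auto
      \<comment> \<open>Lifting \<open>q\<close> to height \<open>- f \<epsilon> q\<close> cancels
        the last component, so equal base images become equal values of \<open>t \<epsilon>\<close>,
        to which the injectivity in (E+) applies.\<close>
      have *: "t \<epsilon> (at_height q (- f \<epsilon> q)) = at_height (\<phi> \<epsilon> q) 0" if "q \<in> ?K" for q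
        using t_form'[OF \<open>0 < \<epsilon>\<close> \<epsilon>(1), of "at_height q (- f \<epsilon> q)"] base_Lam[of "at_height q (- f \<epsilon> q)"] that
        by (simp add: mem_Lam_iff)
      have "inj_on (t \<epsilon>) (Z \<alpha>)" using t_E[OF that(1) \<epsilon>(2)] by blast
      moreover have "t \<epsilon> (at_height q (- f \<epsilon> q)) = t \<epsilon> (at_height q' (- f \<epsilon> q'))"
        using *[OF q(1)] *[OF q(2)] eq by simp
      ultimately have "at_height q (- f \<epsilon> q) = at_height q' (- f \<epsilon> q')"
        by (rule inj_onD) (use q in \<open>simp_all add: Z\<close>)
      from arg_cong[OF this, of base] show "q = q'" by simp
    qed
    show "continuous_on ?K \<phi>0"
      unfolding \<phi>0_def by (intro continuous_intros continuous_on_subset[OF x_cont K_ival])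
    have "(\<lambda>(u, X). (u, x (u, X))) = \<phi>0" by (auto simp: \<phi>0_def)
    with W0(4) have "inj_on \<phi>0 W0" by (simp only:)
    then show "inj_on \<phi>0 ?K" by (rule inj_on_subset) (use K in blast)
    show "\<forall>\<^sub>F \<epsilon> in at_right 0. \<forall>q\<in>?K. dist (\<phi> \<epsilon> q) (\<phi>0 q) < d" if d: "0 < d" for d
    proof -
      obtain \<epsilon>0 where "0 < \<epsilon>0"
        "\<forall>\<epsilon>. 0 < \<epsilon> \<and> \<epsilon> \<le> \<epsilon>0 \<and> \<epsilon> \<le> 1 \<longrightarrow> (\<forall>q\<in>?K. dist (\<phi> \<epsilon> q) (\<phi>0 q) < d)"
        using conv[OF d] by blast
      then show ?thesis
        unfolding eventually_at_right_field by (intro exI[of _ "min \<epsilon>0 1"]) simp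
    qed
    show "C * \<epsilon> ^ N \<le> \<bar>ldet (frechet_derivative (t \<epsilon>) (at z))\<bar>"
      if "0 < \<epsilon>" "\<epsilon> \<le> e" "base z \<in> ?K" for \<epsilon> z
      using t_E[OF that(1) order_trans[OF that(2) e(2)]] Z[OF that(3)] by blast
  qed
  then show "\<exists>A B Q D (Tdia :: real \<Rightarrow> real \<times> 'n \<times> real \<Rightarrow> real \<times> 'n \<times> real).
       open A \<and> p \<in> A \<and> A \<subseteq> Lam a b \<and>
       open B \<and> bounded B \<and> B \<subseteq> Lam a b \<and>
       open Q \<and> bounded Q \<and> Q \<subseteq> Lam a b \<and> Q \<subseteq> B \<and>
       open D \<and> bounded D \<and> D \<subseteq> Lam a b \<and> A \<subseteq> D \<and>
       gcbounded UNIV D Tdia \<and>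
       invertible_on (Lam a b) t A UNIV Tdia B Q"
    unfolding q0_def v0_def at_height_base_height .
qed

end
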